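(* Consider the problem of minimizing $J(x(\cdot))=\int_{t_0}^{t_1}L(t,x(t),\dot x(t))\,dt$ over $x(\cdot)\in KC^1(I,\mathbb R^n)$ with $x(t_0)=x_0$, $x(t_1)=x_1$. Let the functions $L$ and $L_{\dot x}$ be twice continuously differentiable in the totality of their variables, and let the admissible function $\bar x(\cdot)$ be a strong local minimum in this problem. Then: (i) Let $\theta\in[t_0,t_1)$ (respectively $\theta\in(t_0,t_1]$), and suppose $\bar x(\cdot)$ is triply differentiable on the right (left) in a semi-neighborhood $[\theta,\theta+\alpha)\subset I$ (respectively $(\theta-\alpha,\theta]\subset I$), $\alpha>0$, of $\theta$. Suppose that for a vector $\eta\neq0$, $\eta\in\mathbb R^n$, and a number $\bar\lambda\in(0,1)$ $$E(\bar L)(\theta+,\eta)=E(\bar L)\big(\theta+,(\bar\lambda-1)^{-1}\bar\lambda\eta\big)=0\quad\text{and}\quad W(\bar L)(\theta+,\bar\lambda,\eta)=0$$ $$\Big(\text{respectively } E(\bar L)(\theta-,\eta)=E(\bar L)\big(\theta-,(\bar\lambda-1)^{-1}\bar\lambda\eta\big)=0\quad\text{and}\quad W(\bar L)(\theta-,\bar\lambda,\eta)=0\Big).$$ Then $$G(\bar L)(\theta+,\bar\lambda,\eta)\ge0\qquad\big(\text{respectively } G(\bar L)(\theta-,\bar\lambda,\eta)\ge0\big).$$ (ii) Let $\theta\in(t_0,t_1)$, suppose $\bar x(\cdot)$ is triply differentiable at $\theta$, and suppose that for a vector $\eta\ne0$ and a number $\bar\lambda\in(0,1)$ $$E(\bar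 L)(\theta,\eta)=E(\bar L)\big(\theta,(\bar\lambda-1)^{-1}\bar\lambda\eta\big)=0.$$ Then $G(\bar L)(\theta,\bar\lambda,\eta)\ge0$.
   Context: Setting. $(a,b)\subset\mathbb R$ is an interval, $I:=[t_0,t_1]\subset(a,b)$ with $t_0<t_1$, $x_0,x_1\in\mathbb R^n$, and $L=L(t,x,\dot x):(a,b)\times\mathbb R^n\times\mathbb R^n\to\mathbb R$ is continuously differentiable in the totality of variables; $L_x,L_{\dot x}$ are its partial gradients (column vectors) with respect to the second and third arguments, $L_{xx}$ the Hessian in the second argument; $T$ denotes transposition. $KC^1(I,\mathbb R^n)$ is the set of piecewise-smooth functions: continuous functions $x:I\to\mathbb R^n$ whose derivative is continuous on $I$ except at finitely many points of $(t_0,t_1)$ (angular points), where $\dot x$ has discontinuities of the first kind (finite one-sided limits); at $t_0$ and $t_1$ the right, respectively left, values of $\dot x$ are finite. A function $x(\cdot)\in KC^1(I,\mathbb R^n)$ with $x(t_0)=x_0$, $x(t_1)=x_1$ is called admissible. An admissible $\bar x(\cdot)$ is a strong local minimum if there is $\bar\delta>0$ such that $J(x(\cdot))\ge J(\bar x(\cdot))$ for all admissible $x(\cdot)$ with $\|x(\cdot)-\bar x(\cdot)\|_{C(I,\mathbb R^n)}\le\bar\delta$. Notation along $\bar x(\cdot)$, for $\xi\in\mathbb R^n$, $\lambda\in[0,1)$: $\bar L(t)=L(t,\bar x(t),\dot{\bar x}(t))$, $\bar L_x(t)=L_x(t,\bar x(t),\dot{\bar x}(t))$, $\bar L_{\dot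 x}(t)=L_{\dot x}(t,\bar x(t),\dot{\bar x}(t))$, $\bar L_{xx}(t,\xi)=L_{xx}(t,\bar x(t),\dot{\bar x}(t)+\xi)$, $$E(\bar L)(t,\xi)=L(t,\bar x(t),\dot{\bar x}(t)+\xi)-\bar L(t)-\bar L_{\dot x}^T(t)\xi,\qquad \Delta\bar L_x(t,\xi)=L_x(t,\bar x(t),\dot{\bar x}(t)+\xi)-\bar L_x(t),$$ $$Q_i(\bar L)(t,\lambda,\xi)=\lambda^iE(\bar L)(t,\xi)+(1-\lambda^i)E(\bar L)\Big(t,\tfrac{\lambda}{\lambda-1}\xi\Big),\quad i=1,2,3,$$ $$M_i(\bar L_x)(t,\lambda,\xi)=\lambda^i\Delta\bar L_x^T(t,\xi)\xi+(1-\lambda)\big(\tfrac12+\lambda\big)^{i-1}\Delta\bar L_x^T\Big(t,\tfrac{\lambda}{\lambda-1}\xi\Big)\xi,\quad i=1,2,$$ $$W(\bar L)(t,\lambda,\xi)=\lambda M_1(\bar L_x)(t,\lambda,\xi)+\frac{d}{dt}Q_2(\bar L)(t,\lambda,\xi),$$ $$G(\bar L)(t,\lambda,\xi)=\lambda^2\xi^T\Big[\lambda\bar L_{xx}(t,\xi)+(1-\lambda)\bar L_{xx}\Big(t,\tfrac{\lambda}{\lambda-1}\xi\Big)\Big]\xi+2\lambda\frac{d}{dt}M_2(\bar L_x)(t,\lambda,\xi)+\frac{d^2}{dt^2}Q_3(\bar L)(t,\lambda,\xi).$$ One-sided values: $F(\theta+)$ (resp. $F(\theta-)$) is the right-hand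 (left-hand) limit of $F$ at $\theta$; for functions not involving $\frac{d}{dt}$ it is obtained by using $\dot{\bar x}(\theta+)$ (resp. $\dot{\bar x}(\theta-)$) in place of $\dot{\bar x}(\theta)$. In $W(\bar L)(\theta\pm,\cdot)$ and $G(\bar L)(\theta\pm,\cdot)$ the derivatives $\frac{d}{dt},\frac{d^2}{dt^2}$ are the corresponding one-sided derivatives at $\theta$ in $t$ (other arguments fixed). *)

theory Defs
  imports "HOL-Analysis.Analysis"
begin

section \<open>Continuous differentiability and gradients\<close>

text \<open>Intended for open \<open>S\<close>, where the derivative (at interior points) is unique.\<close>

definition C1_on :: "'a::real_normed_vector set \<Rightarrow> ('a \<Rightarrow> 'b::real_normed_vector) \<Rightarrow> bool" where
  "C1_on S f \<longleftrightarrow> (\<exists>f'. (\<forall>z\<in>S. (f has_derivative blinfun_apply (f' z)) (at z)) \<and> continuous_on S f')"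

definition C2_on :: "'a::real_normed_vector set \<Rightarrow> ('a \<Rightarrow> 'b::real_normed_vector) \<Rightarrow> bool" where
  "C2_on S f \<longleftrightarrow> (\<exists>f'. (\<forall>z\<in>S. (f has_derivative blinfun_apply (f' z)) (at z)) \<and> C1_on S f')"

definition gradient :: "('a::real_inner \<Rightarrow> real) \<Rightarrow> 'a \<Rightarrow> 'a" where
  "gradient f z = (THE g. GDERIV f z :> g)"

type_synonym 'n lagrangian = "real \<Rightarrow> real^'n \<Rightarrow> real^'n \<Rightarrow> real"

definition L_x :: "'n::finite lagrangian \<Rightarrow> real \<Rightarrow> real^'n \<Rightarrow> real^'n \<Rightarrow> real^'n" where
  "L_x L t y w = gradient (\<lambda>y. L t y w) y"

definition L_xdot :: "'n::finite lagrangian \<Rightarrow> real \<Rightarrow> real^'n \<Rightarrow> real^'n \<Rightarrow> real^'n" where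
  "L_xdot L t y w = gradient (\<lambda>w. L t y w) w"

definition L_xx :: "'n::finite lagrangian \<Rightarrow> real \<Rightarrow> real^'n \<Rightarrow> real^'n \<Rightarrow> real^'n^'n" where
  "L_xx L t y w = jacobian (\<lambda>y. L_x L t y w) (at y)"

section \<open>Piecewise-smooth functions and the variational problem\<close>

text \<open>The derivative on \<open>[t0, t1]\<close>, one-sided at the end points. Its value at an angular point is
  unspecified.\<close>

definition velocity :: "real \<Rightarrow> real \<Rightarrow> (real \<Rightarrow> 'a::real_normed_vector) \<Rightarrow> real \<Rightarrow> 'a" where
  "velocity t0 t1 x t = vector_derivative x (at t within {t0..t1})"

definition KC1 :: "real \<Rightarrow> real \<Rightarrow> (real \<Rightarrow> 'a::real_normed_vector) set" where
  "KC1 t0 t1 = {x. continuous_on {t0..t1} x \<and>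
     (\<exists>S. finite S \<and> S \<subseteq> {t0<..<t1} \<and>
        (\<forall>t\<in>{t0..t1} - S. x differentiable (at t within {t0..t1})) \<and>
        continuous_on ({t0..t1} - S) (velocity t0 t1 x) \<and>
        (\<forall>s\<in>S. (\<exists>l. (velocity t0 t1 x \<longlongrightarrow> l) (at_left s)) \<and>
               (\<exists>r. (velocity t0 t1 x \<longlongrightarrow> r) (at_right s))))}"

definition J :: "'n::finite lagrangian \<Rightarrow> real \<Rightarrow> real \<Rightarrow> (real \<Rightarrow> real^'n) \<Rightarrow> real" where
  "J L t0 t1 x = integral {t0..t1} (\<lambda>t. L t (x t) (velocity t0 t1 x t))"

definition admissible ::
    "real \<Rightarrow> real \<Rightarrow> 'a \<Rightarrow> 'a \<Rightarrow> (real \<Rightarrow> 'a::real_normed_vector) \<Rightarrow> bool" where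
  "admissible t0 t1 x0 x1 x \<longleftrightarrow> x \<in> KC1 t0 t1 \<and> x t0 = x0 \<and> x t1 = x1"

definition C_norm :: "real \<Rightarrow> real \<Rightarrow> (real \<Rightarrow> 'a::real_normed_vector) \<Rightarrow> real" where
  "C_norm t0 t1 x = (SUP t\<in>{t0..t1}. norm (x t))"

definition strong_local_min ::
    "'n::finite lagrangian \<Rightarrow> real \<Rightarrow> real \<Rightarrow> real^'n \<Rightarrow> real^'n \<Rightarrow> (real \<Rightarrow> real^'n) \<Rightarrow> bool" where
  "strong_local_min L t0 t1 x0 x1 xb \<longleftrightarrow> admissible t0 t1 x0 x1 xb \<and>
     (\<exists>\<delta>>0. \<forall>x. admissible t0 t1 x0 x1 x \<and> C_norm t0 t1 (\<lambda>t. x t - xb t) \<le> \<delta>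
        \<longrightarrow> J L t0 t1 x \<ge> J L t0 t1 xb)"

section \<open>Three-fold differentiability\<close>

text \<open>With \<open>S = {\<theta>..<\<theta>+\<alpha>}\<close> or \<open>S = {\<theta>-\<alpha><..\<theta>}\<close> the derivatives at \<open>\<theta>\<close> are one-sided, and those at the
  remaining points of \<open>S\<close> are two-sided.\<close>

definition thrice_differentiable_on :: "(real \<Rightarrow> 'a::real_normed_vector) \<Rightarrow> real set \<Rightarrow> bool" where
  "thrice_differentiable_on x S \<longleftrightarrow> (\<exists>x' x'' x'''. \<forall>t\<in>S.
     (x has_vector_derivative x' t) (at t within S) \<and>
     (x' has_vector_derivative x'' t) (at t within S) \<and>
     (x'' has_vector_derivative x''' t) (at t within S))"

definition thrice_differentiable_at :: "(real \<Rightarrow> 'a::real_normed_vector) \<Rightarrow> real \<Rightarrow> bool" where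
  "thrice_differentiable_at x \<theta> \<longleftrightarrow> (\<exists>\<epsilon>>0. \<exists>x' x'' d.
     (\<forall>t\<in>{\<theta>-\<epsilon><..<\<theta>+\<epsilon>}. (x has_vector_derivative x' t) (at t) \<and>
                          (x' has_vector_derivative x'' t) (at t)) \<and>
     (x'' has_vector_derivative d) (at \<theta>))"

section \<open>The expressions along a function\<close>

text \<open>The expressions below take the velocity curve \<open>v\<close> as a parameter: for the values at \<open>\<theta>\<close> it is
  \<open>velocity\<close>, and for the values at \<open>\<theta>+\<close> and \<open>\<theta>-\<close> it is \<open>velocity_right\<close> and \<open>velocity_left\<close>, which
  put the one-sided limits of the derivative in place of the derivative. Likewise \<open>W\<close> and \<open>G\<close> take
  the operator \<open>D\<close> standing for d/dt (\<open>deriv\<close>, \<open>deriv_right\<close> or \<open>deriv_left\<close>); it acts on functions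
  of \<open>t\<close>, the other arguments being fixed.\<close>

definition velocity_right :: "real \<Rightarrow> real \<Rightarrow> (real \<Rightarrow> 'a::real_normed_vector) \<Rightarrow> real \<Rightarrow> 'a" where
  "velocity_right t0 t1 x t = Lim (at_right t) (velocity t0 t1 x)"

definition velocity_left :: "real \<Rightarrow> real \<Rightarrow> (real \<Rightarrow> 'a::real_normed_vector) \<Rightarrow> real \<Rightarrow> 'a" where
  "velocity_left t0 t1 x t = Lim (at_left t) (velocity t0 t1 x)"

definition deriv_right :: "(real \<Rightarrow> real) \<Rightarrow> real \<Rightarrow> real" where
  "deriv_right f t = vector_derivative f (at_right t)"

definition deriv_left :: "(real \<Rightarrow> real) \<Rightarrow> real \<Rightarrow> real" where
  "deriv_left f t = vector_derivative f (at_left t)"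

definition E :: "'n::finite lagrangian \<Rightarrow> (real \<Rightarrow> real^'n) \<Rightarrow> (real \<Rightarrow> real^'n) \<Rightarrow>
    real \<Rightarrow> real^'n \<Rightarrow> real" where
  "E L x v t \<xi> = L t (x t) (v t + \<xi>) - L t (x t) (v t) - L_xdot L t (x t) (v t) \<bullet> \<xi>"

definition Delta_L_x :: "'n::finite lagrangian \<Rightarrow> (real \<Rightarrow> real^'n) \<Rightarrow> (real \<Rightarrow> real^'n) \<Rightarrow>
    real \<Rightarrow> real^'n \<Rightarrow> real^'n" where
  "Delta_L_x L x v t \<xi> = L_x L t (x t) (v t + \<xi>) - L_x L t (x t) (v t)"

definition Q :: "nat \<Rightarrow> 'n::finite lagrangian \<Rightarrow> (real \<Rightarrow> real^'n) \<Rightarrow> (real \<Rightarrow> real^'n) \<Rightarrow>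
    real \<Rightarrow> real \<Rightarrow> real^'n \<Rightarrow> real" where
  "Q i L x v t lam \<xi> = lam ^ i * E L x v t \<xi> + (1 - lam ^ i) * E L x v t ((lam / (lam - 1)) *\<^sub>R \<xi>)"

definition M :: "nat \<Rightarrow> 'n::finite lagrangian \<Rightarrow> (real \<Rightarrow> real^'n) \<Rightarrow> (real \<Rightarrow> real^'n) \<Rightarrow>
    real \<Rightarrow> real \<Rightarrow> real^'n \<Rightarrow> real" where
  "M i L x v t lam \<xi> = lam ^ i * (Delta_L_x L x v t \<xi> \<bullet> \<xi>) +
     (1 - lam) * (1/2 + lam) ^ (i - 1) * (Delta_L_x L x v t ((lam / (lam - 1)) *\<^sub>R \<xi>) \<bullet> \<xi>)"

definition W :: "((real \<Rightarrow> real) \<Rightarrow> real \<Rightarrow> real) \<Rightarrow> 'n::finite lagrangian \<Rightarrow>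
    (real \<Rightarrow> real^'n) \<Rightarrow> (real \<Rightarrow> real^'n) \<Rightarrow> real \<Rightarrow> real \<Rightarrow> real^'n \<Rightarrow> real" where
  "W D L x v t lam \<xi> = lam * M 1 L x v t lam \<xi> + D (\<lambda>s. Q 2 L x v s lam \<xi>) t"

definition G :: "((real \<Rightarrow> real) \<Rightarrow> real \<Rightarrow> real) \<Rightarrow> 'n::finite lagrangian \<Rightarrow>
    (real \<Rightarrow> real^'n) \<Rightarrow> (real \<Rightarrow> real^'n) \<Rightarrow> real \<Rightarrow> real \<Rightarrow> real^'n \<Rightarrow> real" where
  "G D L x v t lam \<xi> =
     lam\<^sup>2 * (\<xi> \<bullet> ((lam *\<^sub>R L_xx L t (x t) (v t + \<xi>) +
               (1 - lam) *\<^sub>R L_xx L t (x t) (v t + (lam / (lam - 1)) *\<^sub>R \<xi>)) *v \<xi>)) +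
     2 * lam * D (\<lambda>s. M 2 L x v s lam \<xi>) t +
     D (D (\<lambda>s. Q 3 L x v s lam \<xi>)) t"

end

theory Submission
  imports Defs
begin

text \<open>The minimizer is compared with the variations \<open>x + h\<close>, where \<open>h(t) = (t - \<theta>) \<eta>\<close> between \<open>\<theta>\<close> and
  \<open>\<theta> + \<lambda> e\<close>, \<open>h(t) = (\<lambda> / (\<lambda> - 1)) (t - \<theta> - e) \<eta>\<close> between \<open>\<theta> + \<lambda> e\<close> and \<open>\<theta> + e\<close>, and \<open>h = 0\<close> elsewhere.
  The number \<open>e\<close> is signed, \<open>e < 0\<close> giving the variations to the left of \<open>\<theta>\<close>. A Taylor expansion at \<open>\<theta>\<close>,
  combined with the Euler equation near \<open>\<theta>\<close> and its derivative at \<open>\<theta>\<close>, shows that the increment of \<open>J\<close> is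
  \<open>sgn e (e\<^sup>2 W / 2 + e\<^sup>3 G / 6) + o(\<bar>e\<bar>\<^sup>3)\<close> once both \<open>E\<close> terms vanish. If \<open>W = 0\<close>, then \<open>G \<ge> 0\<close> follows. If
  \<open>e\<close> may take both signs, the leading term changes sign with \<open>e\<close>, which forces \<open>W = 0\<close>.\<close>

section \<open>Piecewise-smooth functions\<close>

text \<open>Regularity shapes the argument. The second derivative of \<open>Q 3\<close> contains
  that of \<open>L_xdot \<bullet> \<eta>\<close> along the arc. It is obtained from the Euler
  equation, which turns the first derivative into \<open>L_x \<bullet> \<eta>\<close>; this is
  differentiated once more at \<theta>. Angular points are kept away by carrying minimality over to
  a short closed interval \<open>{p..q}\<close> on which the minimizer is smooth. The right, left
  and two-sided statements then differ only in the position of \<theta> in \<open>{p..q}\<close>,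
  and every derivative can be taken within \<open>{p..q}\<close>. The second slope
  \<open>c = lam / (lam - 1)\<close> is forced: a variation that grows with slope 1 over the
  fraction \<open>lam\<close> of the interval must return to zero over the fraction
  \<open>1 - lam\<close>, that is, \<open>lam + c * (1 - lam) = 0\<close>. The same relation removes
  the term of order \<open>e\<close> once both excess terms vanish, and it identifies the computed
  coefficients with \<open>W\<close> and \<open>G\<close>, although these contain terms that do not
  occur in the expansion.\<close>

text \<open>Induction on the exceptional set: cut at one of its points \<open>s\<close> and give the
  function at \<open>s\<close> its one-sided limit. On each half \<open>s\<close> is then an end
  point of continuity, so the exceptional set has shrunk; changing one value does not affect
  integrability.\<close>

lemma integrable_piecewise_continuous:
  fixes g :: "real \<Rightarrow> 'a::banach"
  assumes "finite S" "S \<subseteq> {a<..<b}" "continuous_on ({a..b} - S) g"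
    and "\<And>s. s \<in> S \<Longrightarrow> \<exists>l. (g \<longlongrightarrow> l) (at_left s)"
    and "\<And>s. s \<in> S \<Longrightarrow> \<exists>l. (g \<longlongrightarrow> l) (at_right s)"
  shows "g integrable_on {a..b}"
  using assms
proof (induction S arbitrary: a b g rule: finite_psubset_induct)
  case (psubset S)
  show ?case
  proof (cases "S = {}")
    case True
    then show ?thesis using psubset.prems(2) by (simp add: integrable_continuous_real)
  next
    case False
    then obtain s where s: "s \<in> S" by blast
    have ab: "a < s" "s < b" using s psubset.prems(1) by auto
    obtain l r where l: "(g \<longlongrightarrow> l) (at_left s)" and r: "(g \<longlongrightarrow> r) (at_right s)"
      using psubset.prems(3,4)[OF s] by blast
    have lim_cong: "(g(s:=u) \<longlongrightarrow> m) (at x within X) \<longleftrightarrow> (g \<longlongrightarrow> m) (at x within X)" if "x \<noteq> s" for m u x X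
    proof (rule tendsto_cong)
      have "\<forall>\<^sub>F y in at x within X. y \<noteq> s" by (rule eventually_neq_at_within)
      then show "\<forall>\<^sub>F y in at x within X. (g(s:=u)) y = g y"
        by (rule eventually_mono) simp
    qed
    have cont: "continuous_on ({a..b} - S) g" by fact
    have "g(s:=l) integrable_on {a..s}"
    proof (rule psubset.IH[of "S \<inter> {a<..<s}"])
      show "S \<inter> {a<..<s} \<subset> S" using s by auto
      show "continuous_on ({a..s} - S \<inter> {a<..<s}) (g(s := l))"
        unfolding continuous_on
      proof
        fix t assume t: "t \<in> {a..s} - S \<inter> {a<..<s}"
        show "(g(s := l) \<longlongrightarrow> (g(s := l)) t) (at t within {a..s} - S \<inter> {a<..<s})"
        proof (cases "t = s")
          case True
          have "(g \<longlongrightarrow> l) (at s within {a..s} - S \<inter> {a<..<s})"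
            by (rule tendsto_within_subset[OF l[unfolded at_within_Icc_at_left[OF ab(1), symmetric]]]) auto
          moreover have "\<forall>\<^sub>F y in at s within {a..s} - S \<inter> {a<..<s}. (g(s:=l)) y = g y"
            by (simp add: eventually_at_filter)
          ultimately show ?thesis using True by (simp add: tendsto_cong)
        next
          case False
          then have tt: "t \<in> {a..b} - S" "t < s" using t ab psubset.prems(1) by auto
          then have "(g \<longlongrightarrow> g t) (at t within {a..b} - S)" using cont by (simp add: continuous_on)
          moreover have "at t within {a..b} - S = at t within {a..s} - S \<inter> {a<..<s}"
            by (rule at_within_nhd[of _ "{..<s}"]) (use tt ab psubset.prems(1) in auto)
          ultimately show ?thesis using False by (simp add: lim_cong)
        qed
      qed
    next
      fix t assume "t \<in> S \<inter> {a<..<s}"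
      then show "\<exists>m. (g(s:=l) \<longlongrightarrow> m) (at_left t)" "\<exists>m. (g(s:=l) \<longlongrightarrow> m) (at_right t)"
        using psubset.prems(3,4)[of t] by (auto simp: lim_cong)
    qed auto
    then have 1: "g integrable_on {a..s}"
      by (rule integrable_spike[OF _ negligible_sing[of s]]) auto
    have "g(s:=r) integrable_on {s..b}"
    proof (rule psubset.IH[of "S \<inter> {s<..<b}"])
      show "S \<inter> {s<..<b} \<subset> S" using s by auto
      show "continuous_on ({s..b} - S \<inter> {s<..<b}) (g(s := r))"
        unfolding continuous_on
      proof
        fix t assume t: "t \<in> {s..b} - S \<inter> {s<..<b}"
        show "(g(s := r) \<longlongrightarrow> (g(s := r)) t) (at t within {s..b} - S \<inter> {s<..<b})"
        proof (cases "t = s")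
          case True
          have "(g \<longlongrightarrow> r) (at s within {s..b} - S \<inter> {s<..<b})"
            by (rule tendsto_within_subset[OF r[unfolded at_within_Icc_at_right[OF ab(2), symmetric]]]) auto
          moreover have "\<forall>\<^sub>F y in at s within {s..b} - S \<inter> {s<..<b}. (g(s:=r)) y = g y"
            by (simp add: eventually_at_filter)
          ultimately show ?thesis using True by (simp add: tendsto_cong)
        next
          case False
          then have tt: "t \<in> {a..b} - S" "t > s" using t ab psubset.prems(1) by auto
          then have "(g \<longlongrightarrow> g t) (at t within {a..b} - S)" using cont by (simp add: continuous_on)
          moreover have "at t within {a..b} - S = at t within {s..b} - S \<inter> {s<..<b}"
            by (rule at_within_nhd[of _ "{s<..}"]) (use tt ab psubset.prems(1) in auto)
          ultimately show ?thesis using False by (simp add: lim_cong)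
        qed
      qed
    next
      fix t assume "t \<in> S \<inter> {s<..<b}"
      then show "\<exists>m. (g(s:=r) \<longlongrightarrow> m) (at_left t)" "\<exists>m. (g(s:=r) \<longlongrightarrow> m) (at_right t)"
        using psubset.prems(3,4)[of t] by (auto simp: lim_cong)
    qed auto
    then have 2: "g integrable_on {s..b}"
      by (rule integrable_spike[OF _ negligible_sing[of s]]) auto
    show ?thesis using Henstock_Kurzweil_Integration.integrable_combine[OF _ _ 1 2] ab by auto
  qed
qed

lemma velocity_eqI:
  assumes "a < b" "t \<in> {a..b}" "(x has_vector_derivative v) (at t within {a..b})"
  shows "velocity a b x t = v"
  using assms unfolding velocity_def
  by (metis box_real(2) vector_derivative_within_cbox)

text \<open>Off the finite exceptional set the one-sided limits come from continuity. Having them at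
  every point spares later proofs the distinction between regular and angular points.\<close>

lemma KC1_velocity:
  assumes "x \<in> KC1 a b"
  obtains S where "finite S" "S \<subseteq> {a<..<b}"
    "\<And>t. t \<in> {a..b} - S \<Longrightarrow> (x has_vector_derivative velocity a b x t) (at t within {a..b})"
    "continuous_on ({a..b} - S) (velocity a b x)"
    "\<And>t. t \<in> {a<..b} \<Longrightarrow> \<exists>l. (velocity a b x \<longlongrightarrow> l) (at_left t)"
    "\<And>t. t \<in> {a..<b} \<Longrightarrow> \<exists>l. (velocity a b x \<longlongrightarrow> l) (at_right t)"
proof -
  obtain S where S: "finite S" "S \<subseteq> {a<..<b}" "\<forall>t\<in>{a..b} - S. x differentiable (at t within {a..b})"
    "continuous_on ({a..b} - S) (velocity a b x)"
    "\<forall>s\<in>S. (\<exists>l. (velocity a b x \<longlongrightarrow> l) (at_left s)) \<and> (\<exists>r. (velocity a b x \<longlongrightarrow> r) (at_right s))"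
    using assms unfolding KC1_def by blast
  show thesis
  proof (rule that[OF S(1,2) _ S(4)])
    fix t assume "t \<in> {a..b} - S"
    then show "(x has_vector_derivative velocity a b x t) (at t within {a..b})"
      using S(3) by (simp add: velocity_def vector_derivative_works)
  next
    fix t assume t: "t \<in> {a<..b}"
    show "\<exists>l. (velocity a b x \<longlongrightarrow> l) (at_left t)"
    proof (cases "t \<in> S")
      case False
      then have "(velocity a b x \<longlongrightarrow> velocity a b x t) (at t within {a..b} - S)"
        using S(4) t by (simp add: continuous_on)
      moreover have "at_left t = at t within {a..t} - S"
      proof -
        have "open (-S \<inter> {a<..})" using S(1) by (intro open_Int open_Compl finite_imp_closed) auto
        then show ?thesis by (rule at_within_nhd[rotated]) (use False t in auto)
      qed
      moreover have "{a..t} - S \<subseteq> {a..b} - S" using t by auto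
      ultimately show ?thesis by (metis tendsto_within_subset)
    qed (use S(5) in blast)
  next
    fix t assume t: "t \<in> {a..<b}"
    show "\<exists>l. (velocity a b x \<longlongrightarrow> l) (at_right t)"
    proof (cases "t \<in> S")
      case False
      then have "(velocity a b x \<longlongrightarrow> velocity a b x t) (at t within {a..b} - S)"
        using S(4) t by (simp add: continuous_on)
      moreover have "at_right t = at t within {t..b} - S"
      proof -
        have "open (-S \<inter> {..<b})" using S(1) by (intro open_Int open_Compl finite_imp_closed) auto
        then show ?thesis by (rule at_within_nhd[rotated]) (use False t in auto)
      qed
      moreover have "{t..b} - S \<subseteq> {a..b} - S" using t by auto
      ultimately show ?thesis by (metis tendsto_within_subset)
    qed (use S(5) in blast)
  qed
qed

text \<open>One-sided limits of the velocity pass through the jointly continuous \<open>L\<close>,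
  so the integrand is again piecewise continuous.\<close>

lemma KC1_integrable:
  fixes x :: "real \<Rightarrow> real^'n::finite" and L :: "'n lagrangian"
  assumes x: "x \<in> KC1 a b"
    and L: "continuous_on ({a..b} \<times> UNIV \<times> UNIV) (\<lambda>(t, y, w). L t y w)"
  shows "(\<lambda>t. L t (x t) (velocity a b x t)) integrable_on {a..b}"
proof -
  obtain S where S: "finite S" "S \<subseteq> {a<..<b}"
    "continuous_on ({a..b} - S) (velocity a b x)"
    "\<And>t. t \<in> {a<..b} \<Longrightarrow> \<exists>l. (velocity a b x \<longlongrightarrow> l) (at_left t)"
    "\<And>t. t \<in> {a..<b} \<Longrightarrow> \<exists>l. (velocity a b x \<longlongrightarrow> l) (at_right t)"
    using KC1_velocity[OF x] by metis
  have xc: "continuous_on {a..b} x" using x by (simp add: KC1_def)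
  have lim: "((\<lambda>t. L t (x t) (velocity a b x t)) \<longlongrightarrow> L s (x s) l) (at s within X)"
    if "(velocity a b x \<longlongrightarrow> l) (at s within X)" "X \<subseteq> {a..b}" "s \<in> {a..b}" for s l X
  proof -
    have xs: "(x \<longlongrightarrow> x s) (at s within X)"
      using xc that by (metis continuous_on tendsto_within_subset)
    have "((\<lambda>t. (t, x t, velocity a b x t)) \<longlongrightarrow> (s, x s, l)) (at s within X)"
      by (intro tendsto_intros xs that)
    moreover have "\<forall>\<^sub>F t in at s within X. (t, x t, velocity a b x t) \<in> {a..b} \<times> UNIV \<times> UNIV"
      unfolding eventually_at_filter using that(2) by (intro always_eventually) auto
    ultimately have "((\<lambda>t. (\<lambda>(t, y, w). L t y w) (t, x t, velocity a b x t)) \<longlongrightarrow> (\<lambda>(t, y, w). L t y w) (s, x s, l)) (at s within X)"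
      using that(3) by (intro continuous_on_tendsto_compose[OF L]) auto
    then show ?thesis by simp
  qed
  show ?thesis
  proof (rule integrable_piecewise_continuous[OF S(1,2)])
    show "continuous_on ({a..b} - S) (\<lambda>t. L t (x t) (velocity a b x t))"
      using S(3) unfolding continuous_on by (blast intro: lim)
  next
    fix s assume "s \<in> S"
    then have s: "s \<in> {a<..<b}" using S by auto
    obtain l r where l: "(velocity a b x \<longlongrightarrow> l) (at_left s)" and r: "(velocity a b x \<longlongrightarrow> r) (at_right s)"
      using S(4,5)[of s] s by auto
    have "at_left s = at s within {a..s}" "at_right s = at s within {s..b}"
      using s by (simp_all add: at_within_Icc_at_left at_within_Icc_at_right)
    then show "\<exists>l. ((\<lambda>t. L t (x t) (velocity a b x t)) \<longlongrightarrow> l) (at_left s)"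
      "\<exists>l. ((\<lambda>t. L t (x t) (velocity a b x t)) \<longlongrightarrow> l) (at_right s)"
      using lim[of l s "{a..s}"] lim[of r s "{s..b}"] l r s by auto
  qed
qed

section \<open>Locality of the velocity and gluing of arcs\<close>

lemma has_vector_derivative_imp_continuous_on:
  assumes "\<And>t. t \<in> S \<Longrightarrow> (f has_vector_derivative f' t) (at t within S)"
  shows "continuous_on S f"
  using assms by (meson continuous_on_eq_continuous_within has_vector_derivative_continuous)

text \<open>Both the function and the domain may change away from \<open>t\<close>. This allows
  passing between \<open>{a..b}\<close> and a subinterval, even at an end point that the two
  intervals share.\<close>

lemma has_vector_derivative_cong_nhd:
  assumes "open U" "t \<in> U" "X \<inter> U = Y \<inter> U" "t \<in> X" "\<And>s. s \<in> X \<inter> U \<Longrightarrow> x s = y s"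
  shows "(x has_vector_derivative v) (at t within X) \<longleftrightarrow> (y has_vector_derivative v) (at t within Y)"
proof -
  have "at t within X = at t within X \<inter> U" "at t within Y = at t within X \<inter> U"
    by (rule at_within_nhd[of _ U]; use assms in auto)+
  moreover have "(x has_vector_derivative v) (at t within X \<inter> U) \<longleftrightarrow> (y has_vector_derivative v) (at t within X \<inter> U)"
    using assms has_vector_derivative_transform[of t "X \<inter> U"] by (metis IntI)
  ultimately show ?thesis by simp
qed

lemma velocity_cong_nhd:
  assumes "open U" "t \<in> U" "{a..b} \<inter> U = {c..d} \<inter> U" "t \<in> {a..b}" "\<And>s. s \<in> {a..b} \<inter> U \<Longrightarrow> x s = y s"
  shows "velocity a b x t = velocity c d y t"
  using has_vector_derivative_cong_nhd[OF assms] unfolding velocity_def vector_derivative_def by simp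

lemma velocity_cong:
  assumes "\<And>t. t \<in> {a..b} \<Longrightarrow> x t = y t" "t \<in> {a..b}"
  shows "velocity a b x t = velocity a b y t"
  by (rule velocity_cong_nhd[of UNIV]) (use assms in auto)

lemma KC1_cong:
  assumes "\<And>t. t \<in> {a..b} \<Longrightarrow> x t = y t" "x \<in> KC1 a b"
  shows "y \<in> KC1 a b"
proof -
  obtain S where S: "finite S" "S \<subseteq> {a<..<b}"
    "\<And>t. t \<in> {a..b} - S \<Longrightarrow> (x has_vector_derivative velocity a b x t) (at t within {a..b})"
    "continuous_on ({a..b} - S) (velocity a b x)"
    "\<And>t. t \<in> {a<..b} \<Longrightarrow> \<exists>l. (velocity a b x \<longlongrightarrow> l) (at_left t)"
    "\<And>t. t \<in> {a..<b} \<Longrightarrow> \<exists>l. (velocity a b x \<longlongrightarrow> l) (at_right t)"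
    using KC1_velocity[OF assms(2)] by metis
  note vel = velocity_cong[OF assms(1)]
  have ev: "\<forall>\<^sub>F t in at_left s. velocity a b x t = velocity a b y t"
    "\<forall>\<^sub>F t in at_right s. velocity a b x t = velocity a b y t" if "s \<in> {a<..<b}" for s
    using that vel unfolding eventually_at_left_field eventually_at_right_field
    by (intro exI[of _ a] exI[of _ b]; simp)+
  show ?thesis unfolding KC1_def
  proof (intro CollectI conjI exI[of _ S] ballI)
    have "continuous_on {a..b} x" using assms(2) by (simp add: KC1_def)
    then show "continuous_on {a..b} y" by (rule continuous_on_eq) (use assms(1) in auto)
    show "y differentiable at t within {a..b}" if "t \<in> {a..b} - S" for t
      using S(3)[OF that] has_vector_derivative_transform[of t "{a..b}" y x] assms(1) that
      by (metis DiffD1 differentiableI_vector)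
    show "continuous_on ({a..b} - S) (velocity a b y)"
      using S(4) by (rule continuous_on_eq) (use vel in auto)
    fix s assume "s \<in> S"
    then have s: "s \<in> {a<..<b}" using S(2) by auto
    then show "\<exists>l. (velocity a b y \<longlongrightarrow> l) (at_left s)" "\<exists>l. (velocity a b y \<longlongrightarrow> l) (at_right s)"
      using S(5,6)[of s] by (simp_all add: tendsto_cong[OF ev(1)[OF s]] tendsto_cong[OF ev(2)[OF s]])
  qed (use S in auto)
qed

text \<open>Gluing creates new corners only at \<open>p\<close> and \<open>q\<close>, so the
  exceptional set grows by at most these two points. No velocity is claimed there, since the slopes
  on the two sides may differ.\<close>

lemma KC1_replace:
  assumes x: "x \<in> KC1 a b" and y: "y \<in> KC1 p q" and ord: "a \<le> p" "p < q" "q \<le> b"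
    and eq: "\<And>t. t \<in> {a..p} \<union> {q..b} \<Longrightarrow> y t = x t"
  shows "y \<in> KC1 a b"
    and "\<And>t. t \<in> {a..b} - {p..q} \<Longrightarrow> velocity a b y t = velocity a b x t"
    and "\<And>t. t \<in> {p<..<q} \<Longrightarrow> velocity a b y t = velocity p q y t"
proof -
  show vx: "velocity a b y t = velocity a b x t" if "t \<in> {a..b} - {p..q}" for t
    by (rule velocity_cong_nhd[of "-{p..q}"]) (use that eq in auto)
  show vy: "velocity a b y t = velocity p q y t" if "t \<in> {p<..<q}" for t
    by (rule velocity_cong_nhd[of "{p<..<q}"]) (use that ord in auto)
  obtain S1 where S1: "finite S1" "S1 \<subseteq> {a<..<b}"
    "\<And>t. t \<in> {a..b} - S1 \<Longrightarrow> (x has_vector_derivative velocity a b x t) (at t within {a..b})"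
    "continuous_on ({a..b} - S1) (velocity a b x)"
    "\<And>t. t \<in> {a<..b} \<Longrightarrow> \<exists>l. (velocity a b x \<longlongrightarrow> l) (at_left t)"
    "\<And>t. t \<in> {a..<b} \<Longrightarrow> \<exists>l. (velocity a b x \<longlongrightarrow> l) (at_right t)"
    using KC1_velocity[OF x] by metis
  obtain S2 where S2: "finite S2" "S2 \<subseteq> {p<..<q}"
    "\<And>t. t \<in> {p..q} - S2 \<Longrightarrow> (y has_vector_derivative velocity p q y t) (at t within {p..q})"
    "continuous_on ({p..q} - S2) (velocity p q y)"
    "\<And>t. t \<in> {p<..q} \<Longrightarrow> \<exists>l. (velocity p q y \<longlongrightarrow> l) (at_left t)"
    "\<And>t. t \<in> {p..<q} \<Longrightarrow> \<exists>l. (velocity p q y \<longlongrightarrow> l) (at_right t)"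
    using KC1_velocity[OF y] by metis
  define S where "S = S1 \<union> S2 \<union> ({p, q} \<inter> {a<..<b})"
  \<comment> \<open>\<open>U\<close> contains \<open>p\<close> exactly when \<open>p = a\<close>,
    and \<open>q\<close> exactly when \<open>q = b\<close>. So \<open>{a..b}\<close> and
    \<open>{p..q}\<close> agree on the open set \<open>U\<close>, and a shared end point does not
    become a corner.\<close>
  define U where "U = {(if p = a then a - 1 else p)<..<(if q = b then b + 1 else q)}"
  have U: "open U" "{a..b} \<inter> U = {p..q} \<inter> U" using ord by (auto simp: U_def)
  have in_U: "t \<in> U" if "t \<in> {p..q}" "t \<notin> S" for t
    using that ord by (auto simp: U_def S_def)
  have vU: "velocity a b y t = velocity p q y t" if "t \<in> {p..q} \<inter> U" for t
    by (rule velocity_cong_nhd[OF U(1) _ U(2)]) (use that ord in auto)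
  show "y \<in> KC1 a b" unfolding KC1_def
  proof (intro CollectI conjI exI[of _ S] ballI)
    have "continuous_on ({a..p} \<union> ({p..q} \<union> {q..b})) y"
    proof (intro continuous_on_closed_Un)
      have c: "continuous_on {a..b} x" "continuous_on {p..q} y" using x y by (auto simp: KC1_def)
      show "continuous_on {p..q} y" by fact
      show "continuous_on {a..p} y" "continuous_on {q..b} y"
        by (rule continuous_on_eq[of _ x], rule continuous_on_subset[OF c(1)]; use ord eq in auto)+
    qed auto
    moreover have "{a..p} \<union> ({p..q} \<union> {q..b}) = {a..b}" using ord by auto
    ultimately show "continuous_on {a..b} y" by simp
    show "finite S" "S \<subseteq> {a<..<b}" using S1(1,2) S2(1,2) ord by (auto simp: S_def)
    show "y differentiable at t within {a..b}" if t: "t \<in> {a..b} - S" for t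
    proof (cases "t \<in> {p..q}")
      case True
      then have "(y has_vector_derivative velocity p q y t) (at t within {p..q})"
        using t S2(3) by (auto simp: S_def)
      then have "(y has_vector_derivative velocity p q y t) (at t within {a..b})"
        by (subst has_vector_derivative_cong_nhd[of U t "{a..b}" "{p..q}" y y]) (use U True in_U[of t] t in auto)
      then show ?thesis by (rule differentiableI_vector)
    next
      case False
      have "(x has_vector_derivative velocity a b x t) (at t within {a..b})"
        using t S1(3) by (auto simp: S_def)
      then have "(y has_vector_derivative velocity a b x t) (at t within {a..b})"
        by (subst has_vector_derivative_cong_nhd[of "-{p..q}" t "{a..b}" "{a..b}" y x]) (use t False eq in auto)
      then show ?thesis by (rule differentiableI_vector)
    qed
    show "continuous_on ({a..b} - S) (velocity a b y)" unfolding continuous_on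
    proof
      fix t assume t: "t \<in> {a..b} - S"
      show "(velocity a b y \<longlongrightarrow> velocity a b y t) (at t within {a..b} - S)"
      proof (cases "t \<in> {p..q}")
        case True
        then have tU: "t \<in> U" using in_U t by auto
        have sub: "({a..b} - S) \<inter> U \<subseteq> {p..q} - S2" using U(2) by (auto simp: S_def)
        have "(velocity p q y \<longlongrightarrow> velocity p q y t) (at t within {p..q} - S2)"
          using S2(4) True t by (auto simp: continuous_on S_def)
        then have "(velocity p q y \<longlongrightarrow> velocity p q y t) (at t within ({a..b} - S) \<inter> U)"
          using sub by (rule tendsto_within_subset)
        moreover have "\<forall>\<^sub>F s in at t within ({a..b} - S) \<inter> U. velocity p q y s = velocity a b y s"
          unfolding eventually_at_filter by (rule always_eventually) (use vU sub in auto)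
        ultimately have "(velocity a b y \<longlongrightarrow> velocity p q y t) (at t within ({a..b} - S) \<inter> U)"
          by (simp add: tendsto_cong)
        moreover have "at t within ({a..b} - S) \<inter> U = at t within {a..b} - S"
          by (rule at_within_nhd[OF tU U(1)]) auto
        ultimately show ?thesis using vU[of t] True tU by simp
      next
        case False
        let ?V = "-{p..q}"
        have "(velocity a b x \<longlongrightarrow> velocity a b x t) (at t within {a..b} - S1)"
          using S1(4) t by (auto simp: continuous_on S_def)
        then have "(velocity a b x \<longlongrightarrow> velocity a b x t) (at t within ({a..b} - S) \<inter> ?V)"
          by (rule tendsto_within_subset) (auto simp: S_def)
        moreover have "\<forall>\<^sub>F s in at t within ({a..b} - S) \<inter> ?V. velocity a b x s = velocity a b y s"
          unfolding eventually_at_filter by (rule always_eventually) (use vx in auto)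
        ultimately have "(velocity a b y \<longlongrightarrow> velocity a b x t) (at t within ({a..b} - S) \<inter> ?V)"
          by (simp add: tendsto_cong)
        moreover have "at t within ({a..b} - S) \<inter> ?V = at t within {a..b} - S"
          by (rule at_within_nhd[of t ?V]) (use False in auto)
        ultimately show ?thesis using vx[of t] False t by simp
      qed
    qed
    fix s assume "s \<in> S"
    then have s: "s \<in> {a<..<b}" using \<open>S \<subseteq> {a<..<b}\<close> by auto
    show "\<exists>l. (velocity a b y \<longlongrightarrow> l) (at_left s)"
    proof (cases "s \<in> {p<..q}")
      case True
      have "\<forall>\<^sub>F t in at_left s. velocity p q y t = velocity a b y t"
        unfolding eventually_at_left_field by (rule exI[of _ p]) (use True vy in auto)
      then show ?thesis using S2(5)[OF True] by (auto simp: tendsto_cong)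
    next
      case False
      have "\<forall>\<^sub>F t in at_left s. velocity a b x t = velocity a b y t"
        unfolding eventually_at_left_field
        by (rule exI[of _ "if s \<le> p then a else q"]) (use s False vx ord in auto)
      then show ?thesis using S1(5)[of s] s by (auto simp: tendsto_cong)
    qed
    show "\<exists>l. (velocity a b y \<longlongrightarrow> l) (at_right s)"
    proof (cases "s \<in> {p..<q}")
      case True
      have "\<forall>\<^sub>F t in at_right s. velocity p q y t = velocity a b y t"
        unfolding eventually_at_right_field by (rule exI[of _ q]) (use True vy in auto)
      then show ?thesis using S2(6)[OF True] by (auto simp: tendsto_cong)
    next
      case False
      have "\<forall>\<^sub>F t in at_right s. velocity a b x t = velocity a b y t"
        unfolding eventually_at_right_field
        by (rule exI[of _ "if s < p then p else b"]) (use s False vx ord in auto)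
      then show ?thesis using S1(6)[of s] s by (auto simp: tendsto_cong)
    qed
  qed
qed

section \<open>Localization of the functional and of minimality\<close>

lemma integral_split3:
  fixes f :: "real \<Rightarrow> 'a::banach"
  assumes "f integrable_on {a..b}" "a \<le> p" "p \<le> q" "q \<le> b"
  shows "integral {a..b} f = integral {a..p} f + integral {p..q} f + integral {q..b} f"
proof -
  have "f integrable_on {a..q}" by (rule integrable_on_subinterval[OF assms(1)]) (use assms in auto)
  then have "integral {a..p} f + integral {p..q} f = integral {a..q} f"
    using assms by (intro Henstock_Kurzweil_Integration.integral_combine) auto
  moreover have "integral {a..q} f + integral {q..b} f = integral {a..b} f"
    using assms by (intro Henstock_Kurzweil_Integration.integral_combine) auto
  ultimately show ?thesis by simp
qed

text \<open>The integrands of \<open>x\<close> and \<open>y\<close> differ only over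
  \<open>{p..q}\<close>. At \<open>p\<close> and \<open>q\<close> the velocities may jump, but two
  points do not affect an integral.\<close>

lemma J_replace:
  fixes x y :: "real \<Rightarrow> real^'n::finite"
  assumes x: "x \<in> KC1 a b" "x \<in> KC1 p q" and y: "y \<in> KC1 p q" and ord: "a \<le> p" "p < q" "q \<le> b"
    and eq: "\<And>t. t \<in> {a..p} \<union> {q..b} \<Longrightarrow> y t = x t"
    and L: "continuous_on ({a..b} \<times> UNIV \<times> UNIV) (\<lambda>(t, y, w). L t y w)"
  shows "J L a b y - J L a b x = J L p q y - J L p q x"
proof -
  define F where "F z = (\<lambda>t. L t (z t) (velocity a b z t))" for z
  note rep = KC1_replace[OF x(1) y ord eq]
  \<comment> \<open>Replacing \<open>x\<close> by itself shows that its velocities relative to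
    \<open>{a..b}\<close> and to \<open>{p..q}\<close> agree on \<open>{p<..<q}\<close>.\<close>
  note self = KC1_replace[OF x ord refl]
  have split: "J L a b z = integral {a..p} (F z) + integral {p..q} (F z) + integral {q..b} (F z)"
    if "z \<in> KC1 a b" for z
    using integral_split3[OF KC1_integrable[OF that L] ord(1) less_imp_le[OF ord(2)] ord(3)]
    by (simp add: J_def F_def)
  have "integral {a..p} (F y) = integral {a..p} (F x)" "integral {q..b} (F y) = integral {q..b} (F x)"
    by (rule integral_spike[of "{p, q}"]; use rep(2) ord eq in \<open>auto simp: F_def\<close>)+
  moreover have "integral {p..q} (F x) = J L p q x" "integral {p..q} (F y) = J L p q y" unfolding J_def
    by (rule integral_spike[of "{p, q}"]; use rep(3) self(3) ord in \<open>auto simp: F_def\<close>)+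
  ultimately show ?thesis using split[OF x(1)] split[OF rep(1)] by simp
qed

lemma J_cong:
  assumes "\<And>t. t \<in> {a..b} \<Longrightarrow> x t = y t"
  shows "J L a b x = J L a b y"
  unfolding J_def by (rule integral_cong) (use assms velocity_cong[of a b x y] in auto)

text \<open>A competitor on \<open>{p..q}\<close> with the end values of \<open>x\<close> is
  continued by \<open>x\<close>. The bound on the distance survives the continuation, and the
  difference of the two values of \<open>J\<close> is the one over \<open>{p..q}\<close>.\<close>

lemma strong_local_min_local:
  fixes x :: "real \<Rightarrow> real^'n::finite"
  assumes min: "strong_local_min L t0 t1 x0 x1 x"
    and L: "continuous_on ({t0..t1} \<times> UNIV \<times> UNIV) (\<lambda>(t, y, w). L t y w)"
  obtains \<delta> where "\<delta> > 0"
    "\<And>p q y. t0 \<le> p \<Longrightarrow> p < q \<Longrightarrow> q \<le> t1 \<Longrightarrow> x \<in> KC1 p q \<Longrightarrow> y \<in> KC1 p q \<Longrightarrow> y p = x p \<Longrightarrow> y q = x q \<Longrightarrow>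
       (\<And>t. t \<in> {p..q} \<Longrightarrow> norm (y t - x t) \<le> \<delta>) \<Longrightarrow> J L p q x \<le> J L p q y"
proof -
  obtain \<delta> where d: "\<delta> > 0" "\<And>y. admissible t0 t1 x0 x1 y \<Longrightarrow> C_norm t0 t1 (\<lambda>t. y t - x t) \<le> \<delta> \<Longrightarrow> J L t0 t1 x \<le> J L t0 t1 y"
    using min unfolding strong_local_min_def by blast
  have x: "x \<in> KC1 t0 t1" "x t0 = x0" "x t1 = x1"
    using min by (auto simp: strong_local_min_def admissible_def)
  show thesis
  proof (rule that[OF d(1)])
    fix p q y assume ord: "t0 \<le> p" "p < q" "q \<le> t1" and xy: "x \<in> KC1 p q" "y \<in> KC1 p q" "y p = x p" "y q = x q"
      and le: "\<And>t. t \<in> {p..q} \<Longrightarrow> norm (y t - x t) \<le> \<delta>"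
    define z where "z t = (if t \<in> {p..q} then y t else x t)" for t
    have z: "z \<in> KC1 p q" using KC1_cong[OF _ xy(2), of z] by (auto simp: z_def)
    have eq: "z t = x t" if "t \<in> {t0..p} \<union> {q..t1}" for t using that xy by (auto simp: z_def)
    have "admissible t0 t1 x0 x1 z" unfolding admissible_def
      using KC1_replace(1)[OF x(1) z ord eq] x(2,3) eq[of t0] eq[of t1] ord by auto
    moreover have "C_norm t0 t1 (\<lambda>t. z t - x t) \<le> \<delta>" unfolding C_norm_def
      by (rule cSUP_least) (use ord le d(1) in \<open>auto simp: z_def\<close>)
    ultimately have "J L t0 t1 x \<le> J L t0 t1 z" by (rule d(2))
    then have "J L p q x \<le> J L p q z" using J_replace[OF x(1) xy(1) z ord eq L] by simp
    also have "J L p q z = J L p q y" by (rule J_cong) (simp add: z_def)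
    finally show "J L p q x \<le> J L p q y" .
  qed
qed

section \<open>Smooth arcs and arcs with one corner\<close>

lemma KC1_C1:
  assumes "p < q" "\<And>t. t \<in> {p..q} \<Longrightarrow> (y has_vector_derivative w t) (at t within {p..q})" "continuous_on {p..q} w"
  shows "y \<in> KC1 p q" "J L p q y = integral {p..q} (\<lambda>t. L t (y t) (w t))"
proof -
  have v: "velocity p q y t = w t" if "t \<in> {p..q}" for t
    using assms(2)[OF that] velocity_eqI assms(1) that by blast
  show "y \<in> KC1 p q" unfolding KC1_def
  proof (intro CollectI conjI exI[of _ "{}"])
    show "continuous_on {p..q} y" using assms(2) by (rule has_vector_derivative_imp_continuous_on)
    show "\<forall>t\<in>{p..q} - {}. y differentiable at t within {p..q}" 
      using assms(2) differentiableI_vector by blast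
    show "continuous_on ({p..q} - {}) (velocity p q y)"
      using continuous_on_eq[OF assms(3), of "velocity p q y"] v by simp
  qed auto
  show "J L p q y = integral {p..q} (\<lambda>t. L t (y t) (w t))"
    unfolding J_def by (rule integral_cong) (simp add: v)
qed

text \<open>Serves the two-slope competitor, whose corner is at \<open>r\<close>. The functional is
  expressed through \<open>w1\<close> and \<open>w2\<close>, which are continuous up to
  \<open>r\<close>, so that the fundamental theorem applies on each closed piece.\<close>

lemma KC1_two_pieces:
  fixes y :: "real \<Rightarrow> real^'n::finite"
  assumes ord: "p < r" "r < q"
    and y1: "\<And>t. t \<in> {p..r} \<Longrightarrow> (y has_vector_derivative w1 t) (at t within {p..r})" "continuous_on {p..r} w1"
    and y2: "\<And>t. t \<in> {r..q} \<Longrightarrow> (y has_vector_derivative w2 t) (at t within {r..q})" "continuous_on {r..q} w2"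
    and L: "continuous_on ({p..q} \<times> UNIV \<times> UNIV) (\<lambda>(t, y, w). L t y w)"
  shows "y \<in> KC1 p q"
    and "J L p q y = integral {p..r} (\<lambda>t. L t (y t) (w1 t)) + integral {r..q} (\<lambda>t. L t (y t) (w2 t))"
proof -
  have d1: "(y has_vector_derivative w1 t) (at t within {p..q})" if "t \<in> {p..<r}" for t
    by (subst has_vector_derivative_cong_nhd[of "{..<r}" t "{p..q}" "{p..r}" y y]) (use y1(1)[of t] that ord in auto)
  have d2: "(y has_vector_derivative w2 t) (at t within {p..q})" if "t \<in> {r<..q}" for t
    by (subst has_vector_derivative_cong_nhd[of "{r<..}" t "{p..q}" "{r..q}" y y]) (use y2(1)[of t] that ord in auto)
  have v1: "velocity p q y t = w1 t" if "t \<in> {p..<r}" for t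
    using velocity_eqI[OF _ _ d1[OF that]] that ord by auto
  have v2: "velocity p q y t = w2 t" if "t \<in> {r<..q}" for t
    using velocity_eqI[OF _ _ d2[OF that]] that ord by auto
  show K: "y \<in> KC1 p q" unfolding KC1_def
  proof (intro CollectI conjI exI[of _ "{r}"] ballI)
    have "continuous_on ({p..r} \<union> {r..q}) y"
      by (intro continuous_on_closed_Un has_vector_derivative_imp_continuous_on[OF y1(1)] has_vector_derivative_imp_continuous_on[OF y2(1)]) auto
    then show "continuous_on {p..q} y" using ord by (simp add: ivl_disj_un_two_touch)
    show "y differentiable at t within {p..q}" if "t \<in> {p..q} - {r}" for t
      using that d1[of t] d2[of t] by (cases "t < r") (auto intro: differentiableI_vector)
    have "continuous_on {p..<r} (velocity p q y)"
      by (rule continuous_on_eq[of _ w1], rule continuous_on_subset[OF y1(2)]) (use v1 in auto)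
    moreover have "continuous_on {r<..q} (velocity p q y)"
      by (rule continuous_on_eq[of _ w2], rule continuous_on_subset[OF y2(2)]) (use v2 in auto)
    moreover have "openin (top_of_set ({p..<r} \<union> {r<..q})) {p..<r}" "openin (top_of_set ({p..<r} \<union> {r<..q})) {r<..q}"
      unfolding openin_open by (rule exI[of _ "{..<r}"], force, rule exI[of _ "{r<..}"], force)
    ultimately have "continuous_on ({p..<r} \<union> {r<..q}) (velocity p q y)"
      by (intro continuous_on_Un_local_open)
    moreover have "{p..<r} \<union> {r<..q} = {p..q} - {r}" using ord by auto
    ultimately show "continuous_on ({p..q} - {r}) (velocity p q y)" by simp
    fix s assume "s \<in> {r}"
    have "(w1 \<longlongrightarrow> w1 r) (at_left r)" "(w2 \<longlongrightarrow> w2 r) (at_right r)"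
      using y1(2) y2(2) ord by (auto simp: continuous_on at_within_Icc_at_left[symmetric] at_within_Icc_at_right[symmetric])
    moreover have "\<forall>\<^sub>F t in at_left r. w1 t = velocity p q y t"
      unfolding eventually_at_left_field by (rule exI[of _ p]) (use ord v1 in auto)
    moreover have "\<forall>\<^sub>F t in at_right r. w2 t = velocity p q y t"
      unfolding eventually_at_right_field by (rule exI[of _ q]) (use ord v2 in auto)
    ultimately show "\<exists>l. (velocity p q y \<longlongrightarrow> l) (at_left s)" "\<exists>l. (velocity p q y \<longlongrightarrow> l) (at_right s)"
      using \<open>s \<in> {r}\<close> by (auto simp: tendsto_cong)
  qed (use ord in auto)
  have "J L p q y = integral {p..r} (\<lambda>t. L t (y t) (velocity p q y t)) + integral {r..q} (\<lambda>t. L t (y t) (velocity p q y t))"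
    unfolding J_def using ord
    by (intro Henstock_Kurzweil_Integration.integral_combine[symmetric] KC1_integrable[OF K L]) auto
  also have "integral {p..r} (\<lambda>t. L t (y t) (velocity p q y t)) = integral {p..r} (\<lambda>t. L t (y t) (w1 t))"
    by (rule integral_spike[of "{r}"]) (use v1 in auto)
  also have "integral {r..q} (\<lambda>t. L t (y t) (velocity p q y t)) = integral {r..q} (\<lambda>t. L t (y t) (w2 t))"
    by (rule integral_spike[of "{r}"]) (use v2 in auto)
  finally show "J L p q y = integral {p..r} (\<lambda>t. L t (y t) (w1 t)) + integral {r..q} (\<lambda>t. L t (y t) (w2 t))" .
qed

section \<open>The Euler equation\<close>

text \<open>\<open>gradient\<close> is a definite description, so a representing vector must be
  shown to exist and to be unique. It is assembled from the values of \<open>D\<close> on the basis.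
  The lemma translates \<open>L_x\<close> and \<open>L_xdot\<close> into values of the total
  derivative.\<close>

lemma gradient_inner:
  fixes f :: "'a::euclidean_space \<Rightarrow> real"
  assumes "(f has_derivative D) (at z)"
  shows "gradient f z \<bullet> h = D h"
proof -
  have lin: "linear D" using assms by (rule has_derivative_linear)
  define g where "g = (\<Sum>i\<in>Basis. D i *\<^sub>R i)"
  have g: "h \<bullet> g = D h" for h
  proof -
    have "D h = D (\<Sum>i\<in>Basis. (h \<bullet> i) *\<^sub>R i)" by (simp add: euclidean_representation)
    also have "\<dots> = (\<Sum>i\<in>Basis. (h \<bullet> i) * D i)" using lin by (simp add: linear_sum linear_scale)
    finally show ?thesis by (simp add: g_def inner_sum_right mult.commute)
  qed
  have "GDERIV f z :> g" using assms g by (simp add: gderiv_def)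
  moreover have "g' = g" if "GDERIV f z :> g'" for g'
  proof -
    have eq: "(\<lambda>h. h \<bullet> g') = D" using that assms unfolding gderiv_def by (rule has_derivative_unique)
    then have "h \<bullet> g' = h \<bullet> g" for h using g[of h] fun_cong[OF eq, of h] by simp
    then show ?thesis by (simp add: vector_eq_rdot[of g' g, symmetric] inner_commute)
  qed
  ultimately have "gradient f z = g" unfolding gradient_def by (rule the_equality)
  then show ?thesis by (simp add: g[symmetric] inner_commute)
qed

section \<open>A minimizing arc without angular points\<close>

text \<open>\<open>f'\<close> and \<open>f''\<close> are derivatives in all variables jointly;
  partial derivatives are their values on vectors such as \<open>(0, \<eta>, 0)\<close>. Minimality
  is required on every subinterval, because the variations live between \<theta> and
  \<open>\<theta> + e\<close> with \<open>e\<close> tending to 0. Of \<open>x''\<close> only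
  pointwise existence is recorded.\<close>

locale minimizing_arc =
  fixes L :: "'n::finite lagrangian" and T :: "real set"
    and f' :: "real \<times> (real^'n) \<times> (real^'n) \<Rightarrow> (real \<times> (real^'n) \<times> (real^'n)) \<Rightarrow>\<^sub>L real"
    and f'' :: "real \<times> (real^'n) \<times> (real^'n) \<Rightarrow> (real \<times> (real^'n) \<times> (real^'n)) \<Rightarrow>\<^sub>L (real \<times> (real^'n) \<times> (real^'n)) \<Rightarrow>\<^sub>L real"
    and p q \<delta> :: real and x x' x'' :: "real \<Rightarrow> real^'n"
  assumes open_T: "open T" and pq: "p < q" "{p..q} \<subseteq> T"
    and L_deriv: "\<And>t y w. t \<in> T \<Longrightarrow> ((\<lambda>(t, y, w). L t y w) has_derivative f' (t, y, w)) (at (t, y, w))"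
    and f'_deriv: "\<And>t y w. t \<in> T \<Longrightarrow> (f' has_derivative f'' (t, y, w)) (at (t, y, w))"
    and f''_cont: "continuous_on (T \<times> UNIV \<times> UNIV) f''"
    and x_deriv: "\<And>t. t \<in> {p..q} \<Longrightarrow> (x has_vector_derivative x' t) (at t within {p..q})"
    and x'_deriv: "\<And>t. t \<in> {p..q} \<Longrightarrow> (x' has_vector_derivative x'' t) (at t within {p..q})"
    and \<delta>: "\<delta> > 0"
    and minimal: "\<And>a b y. p \<le> a \<Longrightarrow> a < b \<Longrightarrow> b \<le> q \<Longrightarrow> x \<in> KC1 a b \<Longrightarrow> y \<in> KC1 a b \<Longrightarrow>
      y a = x a \<Longrightarrow> y b = x b \<Longrightarrow> (\<And>t. t \<in> {a..b} \<Longrightarrow> norm (y t - x t) \<le> \<delta>) \<Longrightarrow> J L a b x \<le> J L a b y"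
begin

lemma L_cont: "continuous_on (T \<times> UNIV \<times> UNIV) (\<lambda>(t, y, w). L t y w)"
  by (intro continuous_at_imp_continuous_on ballI) (use L_deriv has_derivative_continuous in fastforce)

lemma f'_cont: "continuous_on (T \<times> UNIV \<times> UNIV) f'"
  by (intro continuous_at_imp_continuous_on ballI) (use f'_deriv has_derivative_continuous in fastforce)

lemma L_comp_cont:
  assumes "continuous_on S g" "continuous_on S h" "continuous_on S k" "\<And>s. s \<in> S \<Longrightarrow> g s \<in> T"
  shows "continuous_on S (\<lambda>s. L (g s) (h s) (k s))"
proof -
  have "continuous_on S (\<lambda>s. (\<lambda>(t, y, w). L t y w) (g s, h s, k s))"
    by (rule continuous_on_compose2[OF L_cont]) (use assms in \<open>auto intro!: continuous_intros\<close>)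
  then show ?thesis by simp
qed

lemma f'_comp_cont:
  assumes "continuous_on S g" "continuous_on S h" "continuous_on S k" "\<And>s. s \<in> S \<Longrightarrow> g s \<in> T"
  shows "continuous_on S (\<lambda>s. f' (g s, h s, k s))"
  by (rule continuous_on_compose2[OF f'_cont]) (use assms in \<open>auto intro!: continuous_intros\<close>)

lemma f''_comp_cont:
  assumes "continuous_on S g" "continuous_on S h" "continuous_on S k" "\<And>s. s \<in> S \<Longrightarrow> g s \<in> T"
  shows "continuous_on S (\<lambda>s. f'' (g s, h s, k s))"
  by (rule continuous_on_compose2[OF f''_cont]) (use assms in \<open>auto intro!: continuous_intros\<close>)

lemma in_T: "t \<in> {p..q} \<Longrightarrow> t \<in> T"
  using pq by auto

lemma x_cont: "continuous_on {p..q} x" and x'_cont: "continuous_on {p..q} x'"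
  by (rule has_vector_derivative_imp_continuous_on, erule x_deriv,
      rule has_vector_derivative_imp_continuous_on, erule x'_deriv)

lemma x_C1: 
  assumes "p \<le> a" "a < b" "b \<le> q"
  shows "x \<in> KC1 a b" "J L a b x = integral {a..b} (\<lambda>t. L t (x t) (x' t))"
proof -
  have "(x has_vector_derivative x' t) (at t within {a..b})" if "t \<in> {a..b}" for t
    by (rule has_vector_derivative_within_subset[OF x_deriv]) (use that assms in auto)
  moreover have "continuous_on {a..b} x'"
    by (rule continuous_on_subset[OF x'_cont]) (use assms in auto)
  ultimately show "x \<in> KC1 a b" "J L a b x = integral {a..b} (\<lambda>t. L t (x t) (x' t))"
    using KC1_C1 assms by blast+
qed

lemma L_line_deriv:
  assumes "t \<in> T"
  shows "((\<lambda>s. L t (y + s *\<^sub>R u) (w + s *\<^sub>R v)) has_field_derivative f' (t, y + s *\<^sub>R u, w + s *\<^sub>R v) (0, u, v)) (at s within S)"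
proof -
  have "((\<lambda>s. (t, y + s *\<^sub>R u, w + s *\<^sub>R v)) has_derivative (\<lambda>h. (0, h *\<^sub>R u, h *\<^sub>R v))) (at s within S)"
    by (auto intro!: derivative_eq_intros)
  from has_derivative_compose[OF this L_deriv[OF assms]]
  have "((\<lambda>s. L t (y + s *\<^sub>R u) (w + s *\<^sub>R v)) has_derivative (\<lambda>h. f' (t, y + s *\<^sub>R u, w + s *\<^sub>R v) (0, h *\<^sub>R u, h *\<^sub>R v))) (at s within S)"
    by simp
  moreover have "(0, h *\<^sub>R u, h *\<^sub>R v) = h *\<^sub>R (0::real, u, v)" for h by simp
  ultimately show ?thesis
    by (simp add: has_field_derivative_def blinfun.scaleR_right mult.commute[of _ "blinfun_apply _ _"] del: scaleR_Pair)
qed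

text \<open>The du Bois-Reymond argument: the test function is the antiderivative of \<open>P - C\<close>, where \<open>C\<close> is the
  mean value of \<open>P\<close>.\<close>

lemma euler_equation:
  assumes "t \<in> {p..q}"
  shows "((\<lambda>t. f' (t, x t, x' t) (0, 0, \<eta>)) has_real_derivative f' (t, x t, x' t) (0, \<eta>, 0)) (at t within {p..q})"
proof -
  define a b where "a t = f' (t, x t, x' t) (0, \<eta>, 0)" and "b t = f' (t, x t, x' t) (0, 0, \<eta>)" for t
  have c: "continuous_on {p..q} a" "continuous_on {p..q} b" unfolding a_def b_def
    by (intro continuous_intros f'_comp_cont x_cont x'_cont in_T; assumption)+
  obtain R where R: "\<And>t. t \<in> {p..q} \<Longrightarrow> (R has_vector_derivative a t) (at t within {p..q})"
    using antiderivative_continuous[OF c(1)] by blast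
  have Rc: "continuous_on {p..q} R" using R by (rule has_vector_derivative_imp_continuous_on)
  define P where "P t = b t - R t" for t
  have Pc: "continuous_on {p..q} P" unfolding P_def by (intro continuous_intros c Rc)
  define C where "C = integral {p..q} P / (q - p)"
  define \<phi>' where "\<phi>' t = P t - C" for t
  have \<phi>'c: "continuous_on {p..q} \<phi>'" unfolding \<phi>'_def by (intro continuous_intros Pc)
  define \<phi> where "\<phi> t = integral {p..t} \<phi>'" for t
  have \<phi>: "(\<phi> has_vector_derivative \<phi>' t) (at t within {p..q})" if "t \<in> {p..q}" for t
    unfolding \<phi>_def by (rule integral_has_vector_derivative[OF \<phi>'c that])
  have \<phi>c: "continuous_on {p..q} \<phi>" using \<phi> by (rule has_vector_derivative_imp_continuous_on)
  have \<phi>p: "\<phi> p = 0" by (simp add: \<phi>_def)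
  have \<phi>q: "\<phi> q = 0" using pq(1) Pc
    by (simp add: \<phi>_def \<phi>'_def[abs_def] integral_diff integrable_continuous_real C_def)
  obtain B where B: "\<And>t. t \<in> {p..q} \<Longrightarrow> norm (\<phi> t *\<^sub>R \<eta>) \<le> B" "B > 0"
  proof -
    have "bounded ((\<lambda>t. \<phi> t *\<^sub>R \<eta>) ` {p..q})"
      by (intro compact_imp_bounded compact_continuous_image continuous_intros \<phi>c) auto
    then obtain M where "M > 0" "\<forall>v\<in>(\<lambda>t. \<phi> t *\<^sub>R \<eta>) ` {p..q}. norm v \<le> M" unfolding bounded_pos by blast
    then show ?thesis using that[of M] by blast
  qed
  define F where "F s = integral {p..q} (\<lambda>t. L t (x t + s *\<^sub>R (\<phi> t *\<^sub>R \<eta>)) (x' t + s *\<^sub>R (\<phi>' t *\<^sub>R \<eta>)))" for s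
  \<comment> \<open>\<open>B\<close> bounds the test function, so this range of \<open>s\<close>
    keeps the competitor within \<delta> of \<open>x\<close>; the end values are unchanged because
    \<phi> vanishes at \<open>p\<close> and \<open>q\<close>.\<close>
  have F0: "F 0 \<le> F s" if "\<bar>0 - s\<bar> < \<delta> / B" for s
  proof -
    let ?y = "\<lambda>t. x t + s *\<^sub>R (\<phi> t *\<^sub>R \<eta>)"
    have "(?y has_vector_derivative x' t + s *\<^sub>R (\<phi>' t *\<^sub>R \<eta>)) (at t within {p..q})" if "t \<in> {p..q}" for t
      using x_deriv[OF that] \<phi>[OF that] by (auto intro!: derivative_eq_intros simp: has_real_derivative_iff_has_vector_derivative)
    moreover have "continuous_on {p..q} (\<lambda>t. x' t + s *\<^sub>R (\<phi>' t *\<^sub>R \<eta>))"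
      by (intro continuous_intros x'_cont \<phi>'c)
    ultimately have y: "?y \<in> KC1 p q" "J L p q ?y = F s"
      using KC1_C1[OF pq(1), of ?y "\<lambda>t. x' t + s *\<^sub>R (\<phi>' t *\<^sub>R \<eta>)"] unfolding F_def by blast+
    have "norm (?y t - x t) \<le> \<delta>" if "t \<in> {p..q}" for t
    proof -
      have "norm (?y t - x t) = \<bar>s\<bar> * norm (\<phi> t *\<^sub>R \<eta>)" by (simp add: abs_mult)
      also have "\<dots> \<le> \<delta> / B * B" by (rule mult_mono) (use \<open>\<bar>0 - s\<bar> < \<delta> / B\<close> B(1)[OF that] B(2) \<delta> in auto)
      finally show ?thesis using B(2) by simp
    qed
    then have "J L p q x \<le> J L p q ?y"
      by (intro minimal x_C1 y) (use pq(1) \<phi>p \<phi>q in auto)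
    then show ?thesis using y(2) x_C1(2)[of p q] pq(1) by (simp add: F_def)
  qed
  have "(F has_field_derivative integral {p..q} (\<lambda>t. \<phi> t * a t + \<phi>' t * b t)) (at 0)"
  proof -
    define g where "g s t = f' (t, x t + s *\<^sub>R (\<phi> t *\<^sub>R \<eta>), x' t + s *\<^sub>R (\<phi>' t *\<^sub>R \<eta>)) (0, \<phi> t *\<^sub>R \<eta>, \<phi>' t *\<^sub>R \<eta>)" for s t
    have cc: "continuous_on (UNIV \<times> {p..q}) (\<lambda>z. h (snd z))" if "continuous_on {p..q} h" for h :: "real \<Rightarrow> 'z::real_normed_vector"
      by (rule continuous_on_compose2[OF that]) (auto intro!: continuous_intros)
    have "(F has_field_derivative integral (cbox p q) (g 0)) (at 0 within UNIV)"
      unfolding F_def box_real(2)[symmetric]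
    proof (rule leibniz_rule_field_derivative)
      fix s t assume "t \<in> cbox p q"
      then show "((\<lambda>s. L t (x t + s *\<^sub>R (\<phi> t *\<^sub>R \<eta>)) (x' t + s *\<^sub>R (\<phi>' t *\<^sub>R \<eta>))) has_real_derivative g s t) (at s within UNIV)"
        unfolding g_def by (intro L_line_deriv in_T) auto
    next
      fix s :: real
      show "(\<lambda>t. L t (x t + s *\<^sub>R (\<phi> t *\<^sub>R \<eta>)) (x' t + s *\<^sub>R (\<phi>' t *\<^sub>R \<eta>))) integrable_on cbox p q"
        unfolding box_real
        by (intro integrable_continuous_real L_comp_cont continuous_intros x_cont x'_cont \<phi>c \<phi>'c in_T)
    next
      show "continuous_on (UNIV \<times> cbox p q) (\<lambda>(s, t). g s t)"
        unfolding g_def case_prod_beta box_real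
        by (intro continuous_intros f'_comp_cont cc[OF x_cont] cc[OF x'_cont] cc[OF \<phi>c] cc[OF \<phi>'c] in_T) auto
    qed auto
    moreover have "g 0 = (\<lambda>t. \<phi> t * a t + \<phi>' t * b t)"
    proof
      fix t
      have "(0, \<phi> t *\<^sub>R \<eta>, \<phi>' t *\<^sub>R \<eta>) = \<phi> t *\<^sub>R (0::real, \<eta>, 0) + \<phi>' t *\<^sub>R (0, 0, \<eta>)" by simp
      then show "g 0 t = \<phi> t * a t + \<phi>' t * b t"
        unfolding g_def a_def b_def by (simp add: blinfun.add_right blinfun.scaleR_right del: scaleR_Pair add_Pair)
    qed
    ultimately show ?thesis by simp
  qed
  then have int0: "integral {p..q} (\<lambda>t. \<phi> t * a t + \<phi>' t * b t) = 0"
    by (rule DERIV_local_min[of _ _ _ "\<delta> / B"]) (use F0 \<delta> B(2) in auto)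
  \<comment> \<open>Integration by parts: \<open>R + C\<close> is an antiderivative of
    \<open>a\<close>, and the boundary terms vanish with \<phi>.\<close>
  have ftc: "((\<lambda>t. \<phi> t * a t + \<phi>' t * (R t + C)) has_integral \<phi> q * (R q + C) - \<phi> p * (R p + C)) {p..q}"
  proof (rule fundamental_theorem_of_calculus)
    fix t assume t: "t \<in> {p..q}"
    show "((\<lambda>t. \<phi> t * (R t + C)) has_vector_derivative \<phi> t * a t + \<phi>' t * (R t + C)) (at t within {p..q})"
      using \<phi>[OF t] R[OF t] unfolding has_real_derivative_iff_has_vector_derivative[symmetric]
      by (auto intro!: derivative_eq_intros)
  qed (use pq in auto)
  \<comment> \<open>Since \<open>b - (R + C)\<close> is \<open>\<phi>'\<close>, the difference of
    two vanishing integrals is the integral of the square of \<open>\<phi>'\<close>. Hence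
    \<open>\<phi>' = 0\<close>, and \<open>b = R + C\<close> is differentiable although only
    continuity of \<open>b\<close> has been used.\<close>
  have "integral {p..q} (\<lambda>t. \<phi>' t * \<phi>' t) =
      integral {p..q} (\<lambda>t. (\<phi> t * a t + \<phi>' t * b t) - (\<phi> t * a t + \<phi>' t * (R t + C)))"
    by (rule integral_cong) (simp add: \<phi>'_def P_def algebra_simps)
  also have "\<dots> = 0" using int0 integral_unique[OF ftc] \<phi>p \<phi>q
    by (subst integral_diff) (auto intro!: integrable_continuous_real continuous_intros c \<phi>c \<phi>'c Rc)
  finally have "\<forall>t\<in>{p..q}. \<phi>' t * \<phi>' t = 0"
    by (subst (asm) integral_eq_0_iff) (use pq in \<open>auto intro!: continuous_intros \<phi>'c\<close>)
  then have bR: "b t = R t + C" if "t \<in> {p..q}" for t using that by (force simp: \<phi>'_def P_def)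
  have "((\<lambda>t. R t + C) has_vector_derivative a t) (at t within {p..q})"
    using R[OF assms] by (auto intro!: derivative_eq_intros)
  then have "(b has_vector_derivative a t) (at t within {p..q})"
    by (rule has_vector_derivative_transform[OF assms, rotated]) (rule bR)
  then show ?thesis unfolding has_real_derivative_iff_has_vector_derivative a_def b_def .
qed

end

section \<open>Expansion of the two-slope variation\<close>

lemma Taylor2_Peano:
  fixes A A' :: "real \<Rightarrow> real"
  assumes K: "convex K" "\<theta> \<in> K" and A: "\<And>t. t \<in> K \<Longrightarrow> (A has_real_derivative A' t) (at t within K)"
    and A': "(A' has_real_derivative A2) (at \<theta> within K)" and "\<kappa> > 0"
  obtains d where "d > 0" "\<And>t. t \<in> K \<Longrightarrow> \<bar>t - \<theta>\<bar> < d \<Longrightarrow>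
    \<bar>A t - (A \<theta> + A' \<theta> * (t - \<theta>) + A2 / 2 * (t - \<theta>)\<^sup>2)\<bar> \<le> \<kappa> * (t - \<theta>)\<^sup>2"
proof -
  obtain d where d: "d > 0" "\<And>t. t \<in> K \<Longrightarrow> \<bar>t - \<theta>\<bar> < d \<Longrightarrow> \<bar>A' t - A' \<theta> - A2 * (t - \<theta>)\<bar> \<le> \<kappa> * \<bar>t - \<theta>\<bar>"
    using A' \<open>\<kappa> > 0\<close> unfolding has_field_derivative_def has_derivative_within_alt real_norm_def by metis
  show thesis
  proof (rule that[OF d(1)])
    fix t assume t: "t \<in> K" "\<bar>t - \<theta>\<bar> < d"
    define r where "r s = A s - (A \<theta> + A' \<theta> * (s - \<theta>) + A2 / 2 * (s - \<theta>)\<^sup>2)" for s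
    have sub: "closed_segment \<theta> t \<subseteq> K" using K t by (simp add: closed_segment_subset)
    have near: "\<bar>s - \<theta>\<bar> \<le> \<bar>t - \<theta>\<bar>" if "s \<in> closed_segment \<theta> t" for s
      using that by (auto simp: closed_segment_eq_real_ivl split: if_splits)
    have "norm (r t - r \<theta>) \<le> \<kappa> * \<bar>t - \<theta>\<bar> * norm (t - \<theta>)"
    proof (rule field_differentiable_bound[of "closed_segment \<theta> t" r "\<lambda>s. A' s - A' \<theta> - A2 * (s - \<theta>)"])
      fix s assume s: "s \<in> closed_segment \<theta> t"
      have "(A has_real_derivative A' s) (at s within closed_segment \<theta> t)"
        using A[of s] s sub has_field_derivative_subset by blast
      then show "(r has_real_derivative A' s - A' \<theta> - A2 * (s - \<theta>)) (at s within closed_segment \<theta> t)"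
        unfolding r_def by (auto intro!: derivative_eq_intros)
      have "\<bar>A' s - A' \<theta> - A2 * (s - \<theta>)\<bar> \<le> \<kappa> * \<bar>s - \<theta>\<bar>"
        using d(2)[of s] s sub near[OF s] t(2) by auto
      also have "\<dots> \<le> \<kappa> * \<bar>t - \<theta>\<bar>" using near[OF s] \<open>\<kappa> > 0\<close> by simp
      finally show "norm (A' s - A' \<theta> - A2 * (s - \<theta>)) \<le> \<kappa> * \<bar>t - \<theta>\<bar>" by simp
    qed auto
    then show "\<bar>A t - (A \<theta> + A' \<theta> * (t - \<theta>) + A2 / 2 * (t - \<theta>)\<^sup>2)\<bar> \<le> \<kappa> * (t - \<theta>)\<^sup>2"
      by (simp add: r_def power2_eq_square mult.assoc flip: abs_mult)
  qed
qed

text \<open>Mean value estimate for the difference of the two primitives. Segments have no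
  orientation, so one statement covers variations to the right and to the left of \<theta>.\<close>

lemma increment_bound:
  fixes \<Gamma> :: "real \<Rightarrow> real"
  assumes "\<And>t. t \<in> closed_segment u v \<Longrightarrow> (\<Gamma> has_real_derivative g t) (at t within closed_segment u v)"
    and "\<And>t. t \<in> closed_segment u v \<Longrightarrow> (P has_real_derivative \<rho> t) (at t)"
    and "\<And>t. t \<in> closed_segment u v \<Longrightarrow> \<bar>g t - \<rho> t\<bar> \<le> B"
  shows "\<bar>(\<Gamma> v - \<Gamma> u) - (P v - P u)\<bar> \<le> B * \<bar>v - u\<bar>"
proof -
  have "norm ((\<Gamma> v - P v) - (\<Gamma> u - P u)) \<le> B * norm (v - u)"
  proof (rule field_differentiable_bound)
    fix t assume "t \<in> closed_segment u v"
    then show "((\<lambda>t. \<Gamma> t - P t) has_real_derivative g t - \<rho> t) (at t within closed_segment u v)"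
      "norm (g t - \<rho> t) \<le> B"
      using assms by (auto intro: DERIV_diff has_field_derivative_at_within)
  qed auto
  then show ?thesis by (simp add: algebra_simps)
qed

context minimizing_arc
begin

text \<open>The competitor leaves \<open>x\<close> at \<open>a\<close> with slope \<open>c1\<close>
  and rejoins it at \<open>b\<close> with slope \<open>c2\<close>; the first equation is continuity
  at \<open>r\<close>. Integrals are written as increments of the primitives
  \<open>\<Gamma>1\<close> and \<open>\<Gamma>2\<close>, defined on all of \<open>{p..q}\<close>, so
  that reversing the direction only changes signs. Either of the two slopes of the variation may
  come first.\<close>

lemma two_slope_variation:
  assumes ord: "p \<le> a" "a < r" "r < b" "b \<le> q"
    and c: "c1 * (r - a) = c2 * (r - b)" "\<bar>c1\<bar> * (r - a) * norm \<eta> \<le> \<delta>"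
    and \<Gamma>1: "\<And>t. t \<in> {p..q} \<Longrightarrow> (\<Gamma>1 has_vector_derivative
      L t (x t + (c1 * (t - a)) *\<^sub>R \<eta>) (x' t + c1 *\<^sub>R \<eta>) - L t (x t) (x' t)) (at t within {p..q})"
    and \<Gamma>2: "\<And>t. t \<in> {p..q} \<Longrightarrow> (\<Gamma>2 has_vector_derivative
      L t (x t + (c2 * (t - b)) *\<^sub>R \<eta>) (x' t + c2 *\<^sub>R \<eta>) - L t (x t) (x' t)) (at t within {p..q})"
  shows "\<Gamma>1 r - \<Gamma>1 a + (\<Gamma>2 b - \<Gamma>2 r) \<ge> 0"
proof -
  define y where "y t = x t + (if t \<le> r then c1 * (t - a) else c2 * (t - b)) *\<^sub>R \<eta>" for t
  have y1: "y t = x t + (c1 * (t - a)) *\<^sub>R \<eta>" if "t \<in> {a..r}" for t using that by (simp add: y_def)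
  have y2: "y t = x t + (c2 * (t - b)) *\<^sub>R \<eta>" if "t \<in> {r..b}" for t using that c(1) by (auto simp: y_def)
  have d1: "(y has_vector_derivative x' t + c1 *\<^sub>R \<eta>) (at t within {a..r})" if t: "t \<in> {a..r}" for t
  proof (rule has_vector_derivative_transform[OF t y1])
    have "(x has_vector_derivative x' t) (at t within {a..r})"
      by (rule has_vector_derivative_within_subset[OF x_deriv]) (use t ord in auto)
    then show "((\<lambda>t. x t + (c1 * (t - a)) *\<^sub>R \<eta>) has_vector_derivative x' t + c1 *\<^sub>R \<eta>) (at t within {a..r})"
      by (auto intro!: derivative_eq_intros)
  qed
  have d2: "(y has_vector_derivative x' t + c2 *\<^sub>R \<eta>) (at t within {r..b})" if t: "t \<in> {r..b}" for t
  proof (rule has_vector_derivative_transform[OF t y2])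
    have "(x has_vector_derivative x' t) (at t within {r..b})"
      by (rule has_vector_derivative_within_subset[OF x_deriv]) (use t ord in auto)
    then show "((\<lambda>t. x t + (c2 * (t - b)) *\<^sub>R \<eta>) has_vector_derivative x' t + c2 *\<^sub>R \<eta>) (at t within {r..b})"
      by (auto intro!: derivative_eq_intros)
  qed
  have sub: "{a..r} \<subseteq> {p..q}" "{r..b} \<subseteq> {p..q}" "{a..b} \<subseteq> {p..q}" using ord by auto
  note xc = continuous_on_subset[OF x_cont] continuous_on_subset[OF x'_cont]
  have inT: "t \<in> T" if "t \<in> {a..b}" for t using in_T that ord by auto
  have w1: "continuous_on {a..r} (\<lambda>t. x' t + c1 *\<^sub>R \<eta>)" and w2: "continuous_on {r..b} (\<lambda>t. x' t + c2 *\<^sub>R \<eta>)"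
    by (intro continuous_intros xc sub)+
  have Lc: "continuous_on ({a..b} \<times> UNIV \<times> UNIV) (\<lambda>(t, y, w). L t y w)"
    by (rule continuous_on_subset[OF L_cont]) (use inT in auto)
  have y_KC1: "y \<in> KC1 a b"
    and Jy: "J L a b y = integral {a..r} (\<lambda>t. L t (y t) (x' t + c1 *\<^sub>R \<eta>)) + integral {r..b} (\<lambda>t. L t (y t) (x' t + c2 *\<^sub>R \<eta>))"
    using KC1_two_pieces[OF ord(2,3) d1 w1 d2 w2 Lc] by simp_all
  have "norm (y t - x t) \<le> \<delta>" if t: "t \<in> {a..b}" for t
  proof -
    \<comment> \<open>The deviation is largest at the corner \<open>r\<close>, where both formulas
      give the same value.\<close>
    have "\<bar>if t \<le> r then c1 * (t - a) else c2 * (t - b)\<bar> \<le> \<bar>c1\<bar> * (r - a)"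
    proof (cases "t \<le> r")
      case True
      then show ?thesis using t by (simp add: abs_mult mult_left_mono)
    next
      case False
      then have "\<bar>c2 * (t - b)\<bar> \<le> \<bar>c2\<bar> * (b - r)" using t by (simp add: abs_mult mult_left_mono)
      also have "\<dots> = \<bar>c2 * (r - b)\<bar>" using ord by (simp add: abs_mult)
      also have "\<dots> = \<bar>c1\<bar> * (r - a)" using ord c(1)[symmetric] by (simp add: abs_mult)
      finally show ?thesis using False by simp
    qed
    then have "norm (y t - x t) \<le> \<bar>c1\<bar> * (r - a) * norm \<eta>"
      by (simp add: y_def mult_right_mono)
    then show ?thesis using c(2) by simp
  qed
  then have "J L a b x \<le> J L a b y"
    by (intro minimal x_C1 y_KC1) (use ord in \<open>auto simp: y_def\<close>)
  moreover have "J L a b x = integral {a..r} (\<lambda>t. L t (x t) (x' t)) + integral {r..b} (\<lambda>t. L t (x t) (x' t))"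
  proof -
    have "(\<lambda>t. L t (x t) (x' t)) integrable_on {a..b}"
      by (intro integrable_continuous_real L_comp_cont continuous_intros xc sub inT)
    then show ?thesis using x_C1(2)[of a b] ord
      by (simp add: Henstock_Kurzweil_Integration.integral_combine)
  qed
  moreover have "integral {a..r} (\<lambda>t. L t (y t) (x' t + c1 *\<^sub>R \<eta>)) - integral {a..r} (\<lambda>t. L t (x t) (x' t)) = \<Gamma>1 r - \<Gamma>1 a"
  proof -
    have "integral {a..r} (\<lambda>t. L t (y t) (x' t + c1 *\<^sub>R \<eta>)) = integral {a..r} (\<lambda>t. L t (x t + (c1 * (t - a)) *\<^sub>R \<eta>) (x' t + c1 *\<^sub>R \<eta>))"
      by (rule integral_cong) (simp add: y1)
    moreover have "((\<lambda>t. L t (x t + (c1 * (t - a)) *\<^sub>R \<eta>) (x' t + c1 *\<^sub>R \<eta>) - L t (x t) (x' t)) has_integral \<Gamma>1 r - \<Gamma>1 a) {a..r}"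
      by (rule fundamental_theorem_of_calculus)
        (use ord sub in \<open>auto intro: has_vector_derivative_within_subset[OF \<Gamma>1]\<close>)
    moreover have "(\<lambda>t. L t (x t + (c1 * (t - a)) *\<^sub>R \<eta>) (x' t + c1 *\<^sub>R \<eta>)) integrable_on {a..r}"
      "(\<lambda>t. L t (x t) (x' t)) integrable_on {a..r}"
      by (intro integrable_continuous_real L_comp_cont continuous_intros xc sub inT; use ord in auto)+
    ultimately show ?thesis by (simp add: integral_diff[symmetric] integral_unique)
  qed
  moreover have "integral {r..b} (\<lambda>t. L t (y t) (x' t + c2 *\<^sub>R \<eta>)) - integral {r..b} (\<lambda>t. L t (x t) (x' t)) = \<Gamma>2 b - \<Gamma>2 r"
  proof -
    have "integral {r..b} (\<lambda>t. L t (y t) (x' t + c2 *\<^sub>R \<eta>)) = integral {r..b} (\<lambda>t. L t (x t + (c2 * (t - b)) *\<^sub>R \<eta>) (x' t + c2 *\<^sub>R \<eta>))"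
      by (rule integral_cong) (simp add: y2)
    moreover have "((\<lambda>t. L t (x t + (c2 * (t - b)) *\<^sub>R \<eta>) (x' t + c2 *\<^sub>R \<eta>) - L t (x t) (x' t)) has_integral \<Gamma>2 b - \<Gamma>2 r) {r..b}"
      by (rule fundamental_theorem_of_calculus)
        (use ord sub in \<open>auto intro: has_vector_derivative_within_subset[OF \<Gamma>2]\<close>)
    moreover have "(\<lambda>t. L t (x t + (c2 * (t - b)) *\<^sub>R \<eta>) (x' t + c2 *\<^sub>R \<eta>)) integrable_on {r..b}"
      "(\<lambda>t. L t (x t) (x' t)) integrable_on {r..b}"
      by (intro integrable_continuous_real L_comp_cont continuous_intros xc sub inT; use ord in auto)+
    ultimately show ?thesis by (simp add: integral_diff[symmetric] integral_unique)
  qed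
  ultimately show ?thesis using Jy by simp
qed

text \<open>The functions \<open>A\<close>, \<open>B\<close>, \<open>C\<close> are the value and the first two derivatives in \<open>s\<close>, at \<open>s = 0\<close>, of
  \<open>L t (x t + s \<eta>) (x' t + \<xi>)\<close>; \<open>A'\<close> is the derivative of \<open>A\<close> in \<open>t\<close>.\<close>

definition A :: "real^'n \<Rightarrow> real \<Rightarrow> real" where
  "A \<xi> t = L t (x t) (x' t + \<xi>)"

definition A' :: "real^'n \<Rightarrow> real \<Rightarrow> real" where
  "A' \<xi> t = f' (t, x t, x' t + \<xi>) (1, x' t, x'' t)"

definition B :: "real^'n \<Rightarrow> real^'n \<Rightarrow> real \<Rightarrow> real" where
  "B \<eta> \<xi> t = f' (t, x t, x' t + \<xi>) (0, \<eta>, 0)"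

definition C :: "real^'n \<Rightarrow> real^'n \<Rightarrow> real \<Rightarrow> real" where
  "C \<eta> \<xi> t = f'' (t, x t, x' t + \<xi>) (0, \<eta>, 0) (0, \<eta>, 0)"

lemma curve_deriv:
  assumes "t \<in> {p..q}"
  shows "((\<lambda>t. (t, x t, x' t + \<xi>)) has_vector_derivative (1, x' t, x'' t)) (at t within {p..q})"
  using x_deriv[OF assms] x'_deriv[OF assms]
  by (auto intro!: has_vector_derivative_Pair derivative_eq_intros)

lemma A_deriv:
  assumes "t \<in> {p..q}"
  shows "(A \<xi> has_real_derivative A' \<xi> t) (at t within {p..q})"
proof -
  have "((\<lambda>t. (\<lambda>(t, y, w). L t y w) (t, x t, x' t + \<xi>)) has_vector_derivative A' \<xi> t) (at t within {p..q})"
    using vector_derivative_diff_chain_within[OF curve_deriv[OF assms] has_derivative_at_withinI[OF L_deriv[OF in_T[OF assms]]]]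
    by (simp add: o_def A'_def)
  then show ?thesis by (simp add: has_real_derivative_iff_has_vector_derivative A_def[abs_def])
qed

lemma f'_curve_deriv:
  assumes "t \<in> {p..q}"
  shows "((\<lambda>t. f' (t, x t, x' t + \<xi>)) has_vector_derivative f'' (t, x t, x' t + \<xi>) (1, x' t, x'' t)) (at t within {p..q})"
  using vector_derivative_diff_chain_within[OF curve_deriv[OF assms] has_derivative_at_withinI[OF f'_deriv[OF in_T[OF assms]]]]
  by (simp add: o_def)

lemma B_deriv:
  assumes "t \<in> {p..q}"
  obtains B1 where "(B \<eta> \<xi> has_real_derivative B1) (at t within {p..q})"
proof -
  have "(B \<eta> \<xi> has_vector_derivative f'' (t, x t, x' t + \<xi>) (1, x' t, x'' t) (0, \<eta>, 0)) (at t within {p..q})"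
    unfolding B_def using bounded_linear.has_vector_derivative[OF blinfun.bounded_linear_left f'_curve_deriv[OF assms]] .
  then show thesis using that by (simp add: has_real_derivative_iff_has_vector_derivative)
qed

text \<open>This is where the third derivative of \<open>x\<close> enters: \<open>A'\<close> pairs
  \<open>f'\<close> along the curve with the tangent vector, whose last component is
  \<open>x''\<close>, and the product rule differentiates both factors.\<close>

lemma A'_deriv:
  assumes "\<theta> \<in> {p..q}" "(x'' has_vector_derivative d) (at \<theta> within {p..q})"
  obtains A2 where "(A' \<xi> has_real_derivative A2) (at \<theta> within {p..q})"
proof -
  have "((\<lambda>t. (1::real, x' t, x'' t)) has_vector_derivative (0, x'' \<theta>, d)) (at \<theta> within {p..q})"
    by (intro has_vector_derivative_Pair x'_deriv assms has_vector_derivative_const)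
  from bounded_bilinear.has_vector_derivative[OF bounded_bilinear_blinfun_apply f'_curve_deriv[OF assms(1), of \<xi>] this]
  have "\<exists>A2. (A' \<xi> has_vector_derivative A2) (at \<theta> within {p..q})"
    unfolding A'_def[abs_def] by blast
  then show thesis using that by (auto simp: has_real_derivative_iff_has_vector_derivative)
qed

text \<open>Expansion in two stages, because \<open>x''\<close> need not be continuous. In
  \<open>s\<close> the function is twice continuously differentiable and has a Lagrange remainder;
  its coefficients are then expanded in \<open>t\<close>, \<open>A\<close> to second order,
  \<open>B\<close> to first order, and the remainder term by continuity.\<close>

lemma Taylor_mixed:
  assumes \<theta>: "\<theta> \<in> {p..q}" and A2: "(A' \<xi> has_real_derivative A2) (at \<theta> within {p..q})"
    and B1: "(B \<eta> \<xi> has_real_derivative B1) (at \<theta> within {p..q})" and \<kappa>: "\<kappa> > 0"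
  obtains d where "d > 0" "\<And>t s. t \<in> {p..q} \<Longrightarrow> \<bar>t - \<theta>\<bar> < d \<Longrightarrow> \<bar>s\<bar> < d \<Longrightarrow>
    \<bar>L t (x t + s *\<^sub>R \<eta>) (x' t + \<xi>) - (A \<xi> \<theta> + A' \<xi> \<theta> * (t - \<theta>) + A2 / 2 * (t - \<theta>)\<^sup>2 + s * B \<eta> \<xi> \<theta>
      + s * (t - \<theta>) * B1 + C \<eta> \<xi> \<theta> / 2 * s\<^sup>2)\<bar> \<le> \<kappa> * ((t - \<theta>)\<^sup>2 + s\<^sup>2)"
proof -
  have \<kappa>2: "\<kappa> / 2 > 0" using \<kappa> by simp
  obtain d1 where d1: "d1 > 0" "\<And>t. t \<in> {p..q} \<Longrightarrow> \<bar>t - \<theta>\<bar> < d1 \<Longrightarrow>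
      \<bar>A \<xi> t - (A \<xi> \<theta> + A' \<xi> \<theta> * (t - \<theta>) + A2 / 2 * (t - \<theta>)\<^sup>2)\<bar> \<le> \<kappa>/2 * (t - \<theta>)\<^sup>2"
    using Taylor2_Peano[OF convex_real_interval(5) \<theta> A_deriv A2 \<kappa>2] by blast
  obtain d2 where d2: "d2 > 0" "\<And>t. t \<in> {p..q} \<Longrightarrow> \<bar>t - \<theta>\<bar> < d2 \<Longrightarrow> \<bar>B \<eta> \<xi> t - B \<eta> \<xi> \<theta> - B1 * (t - \<theta>)\<bar> \<le> \<kappa>/2 * \<bar>t - \<theta>\<bar>"
    using B1 \<kappa>2 unfolding has_field_derivative_def has_derivative_within_alt real_norm_def by metis
  define D where "D z = f'' (fst z, x (fst z) + snd z *\<^sub>R \<eta>, x' (fst z) + \<xi>) (0, \<eta>, 0) (0, \<eta>, 0)" for z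
  have "continuous_on ({p..q} \<times> UNIV) D" unfolding D_def
    by (intro continuous_intros f''_comp_cont continuous_on_compose2[OF x_cont] continuous_on_compose2[OF x'_cont] in_T) auto
  then obtain d3 where d3: "d3 > 0" "\<And>z. z \<in> {p..q} \<times> UNIV \<Longrightarrow> dist z (\<theta>, 0) < d3 \<Longrightarrow> dist (D z) (D (\<theta>, 0)) < \<kappa>"
    using \<theta> \<kappa> unfolding continuous_on_iff by (metis SigmaI UNIV_I)
  have D0: "D (\<theta>, 0) = C \<eta> \<xi> \<theta>" by (simp add: D_def C_def)
  show thesis
  \<comment> \<open>Half of \<open>d3\<close> suffices, as the distance in the product is at most
    \<open>\<bar>t - \<theta>\<bar> + \<bar>\<sigma>\<bar>\<close>.\<close>
  proof (rule that[of "min (min d1 d2) (d3 / 2)"])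
    show "min (min d1 d2) (d3 / 2) > 0" using d1 d2 d3 by simp
    fix t s assume t: "t \<in> {p..q}" and near: "\<bar>t - \<theta>\<bar> < min (min d1 d2) (d3 / 2)" "\<bar>s\<bar> < min (min d1 d2) (d3 / 2)"
    define \<tau> where "\<tau> = t - \<theta>"
    \<comment> \<open>The successive derivatives in \<open>s\<close>, arranged as the sequence that
      the Maclaurin formula expects; the last branch matters only for index 2.\<close>
    define g where "g m s = (if m = 0 then L t (x t + s *\<^sub>R \<eta>) (x' t + \<xi>) else
      if m = 1 then f' (t, x t + s *\<^sub>R \<eta>, x' t + \<xi>) (0, \<eta>, 0) else D (t, s))" for m :: nat and s
    have "\<exists>\<sigma>. \<bar>\<sigma>\<bar> \<le> \<bar>s\<bar> \<and> g 0 s = (\<Sum>m<2. g m 0 / fact m * s ^ m) + g 2 \<sigma> / fact 2 * s ^ 2"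
    proof (rule Maclaurin_bi_le[OF refl], intro allI impI)
      fix m :: nat and \<sigma> :: real assume m: "m < 2 \<and> \<bar>\<sigma>\<bar> \<le> \<bar>s\<bar>"
      have 0: "((\<lambda>s. L t (x t + s *\<^sub>R \<eta>) (x' t + \<xi>)) has_real_derivative f' (t, x t + \<sigma> *\<^sub>R \<eta>, x' t + \<xi>) (0, \<eta>, 0)) (at \<sigma>)"
        using L_line_deriv[OF in_T[OF t], of "x t" \<eta> "x' t + \<xi>" 0 \<sigma> UNIV] by simp
      have "((\<lambda>s. (t, x t + s *\<^sub>R \<eta>, x' t + \<xi>)) has_vector_derivative (0, \<eta>, 0)) (at \<sigma>)"
        by (auto intro!: has_vector_derivative_Pair derivative_eq_intros)
      from vector_derivative_diff_chain_within[OF this has_derivative_at_withinI[OF f'_deriv[OF in_T[OF t]]]]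
      have "((\<lambda>s. f' (t, x t + s *\<^sub>R \<eta>, x' t + \<xi>)) has_vector_derivative f'' (t, x t + \<sigma> *\<^sub>R \<eta>, x' t + \<xi>) (0, \<eta>, 0)) (at \<sigma>)"
        by (simp add: o_def)
      from bounded_linear.has_vector_derivative[OF blinfun.bounded_linear_left this, of "(0, \<eta>, 0)"]
      have 1: "((\<lambda>s. f' (t, x t + s *\<^sub>R \<eta>, x' t + \<xi>) (0, \<eta>, 0)) has_real_derivative D (t, \<sigma>)) (at \<sigma>)"
        by (simp add: has_real_derivative_iff_has_vector_derivative D_def)
      from m have "m = 0 \<or> m = 1" by auto
      then show "(g m has_real_derivative g (Suc m) \<sigma>) (at \<sigma>)"
        using 0 1 by (auto simp: g_def[abs_def])
    qed
    then obtain \<sigma> where \<sigma>: "\<bar>\<sigma>\<bar> \<le> \<bar>s\<bar>" "L t (x t + s *\<^sub>R \<eta>) (x' t + \<xi>) = A \<xi> t + B \<eta> \<xi> t * s + D (t, \<sigma>) / 2 * s\<^sup>2"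
      by (auto simp: g_def numeral_2_eq_2 A_def B_def)
    have "dist (t, \<sigma>) (\<theta>, 0) \<le> \<bar>t - \<theta>\<bar> + \<bar>\<sigma>\<bar>"
      by (simp add: dist_Pair_Pair dist_real_def sqrt_sum_squares_le_sum_abs)
    then have "\<bar>D (t, \<sigma>) - C \<eta> \<xi> \<theta>\<bar> \<le> \<kappa>"
      using d3(2)[of "(t, \<sigma>)"] t near \<sigma>(1) D0 by (simp add: dist_real_def)
    then have 3: "\<bar>(D (t, \<sigma>) - C \<eta> \<xi> \<theta>) / 2 * s\<^sup>2\<bar> \<le> \<kappa>/2 * s\<^sup>2"
      by (simp add: abs_mult mult_right_mono)
    have 1: "\<bar>A \<xi> t - (A \<xi> \<theta> + A' \<xi> \<theta> * \<tau> + A2 / 2 * \<tau>\<^sup>2)\<bar> \<le> \<kappa>/2 * \<tau>\<^sup>2"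
      unfolding \<tau>_def using d1(2)[OF t] near(1) by simp
    have "\<bar>s * (B \<eta> \<xi> t - B \<eta> \<xi> \<theta> - B1 * \<tau>)\<bar> \<le> \<bar>s\<bar> * (\<kappa>/2 * \<bar>\<tau>\<bar>)"
      unfolding \<tau>_def abs_mult using d2(2)[OF t] near(1) by (intro mult_left_mono) auto
    \<comment> \<open>The mixed error is split evenly between the two squares, a quarter of \<kappa>
      for each. With the halves from the other two errors, each square collects three quarters of
      \<kappa>.\<close>
    also have "\<dots> \<le> \<kappa>/2 * ((\<tau>\<^sup>2 + s\<^sup>2) / 2)"
    proof -
      have "\<bar>s\<bar> * \<bar>\<tau>\<bar> \<le> (\<tau>\<^sup>2 + s\<^sup>2) / 2" using sum_squares_bound[of "\<bar>s\<bar>" "\<bar>\<tau>\<bar>"] by simp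
      from mult_left_mono[OF this, of "\<kappa>/2"] \<kappa> show ?thesis by (simp add: ac_simps)
    qed
    finally have 2: "\<bar>s * (B \<eta> \<xi> t - B \<eta> \<xi> \<theta> - B1 * \<tau>)\<bar> \<le> \<kappa>/4 * \<tau>\<^sup>2 + \<kappa>/4 * s\<^sup>2" by (simp add: algebra_simps)
    have "L t (x t + s *\<^sub>R \<eta>) (x' t + \<xi>) - (A \<xi> \<theta> + A' \<xi> \<theta> * \<tau> + A2 / 2 * \<tau>\<^sup>2 + s * B \<eta> \<xi> \<theta> + s * \<tau> * B1 + C \<eta> \<xi> \<theta> / 2 * s\<^sup>2)
      = (A \<xi> t - (A \<xi> \<theta> + A' \<xi> \<theta> * \<tau> + A2 / 2 * \<tau>\<^sup>2)) + s * (B \<eta> \<xi> t - B \<eta> \<xi> \<theta> - B1 * \<tau>) + (D (t, \<sigma>) - C \<eta> \<xi> \<theta>) / 2 * s\<^sup>2"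
      (is "?lhs = ?X + ?Y + ?Z")
      unfolding \<sigma>(2) by (simp add: algebra_simps diff_divide_distrib)
    moreover have "\<bar>?X + ?Y + ?Z\<bar> \<le> \<bar>?X\<bar> + \<bar>?Y\<bar> + \<bar>?Z\<bar>" by linarith
    moreover have "\<kappa>/4 * \<tau>\<^sup>2 \<ge> 0" "\<kappa>/4 * s\<^sup>2 \<ge> 0" using \<kappa> by auto
    ultimately have "\<bar>?lhs\<bar> \<le> \<kappa> * \<tau>\<^sup>2 + \<kappa> * s\<^sup>2"
      using 1 2 3 by linarith
    then show "\<bar>L t (x t + s *\<^sub>R \<eta>) (x' t + \<xi>) - (A \<xi> \<theta> + A' \<xi> \<theta> * (t - \<theta>) + A2 / 2 * (t - \<theta>)\<^sup>2 + s * B \<eta> \<xi> \<theta>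
      + s * (t - \<theta>) * B1 + C \<eta> \<xi> \<theta> / 2 * s\<^sup>2)\<bar> \<le> \<kappa> * ((t - \<theta>)\<^sup>2 + s\<^sup>2)"
      unfolding \<tau>_def by (simp only: distrib_left)
  qed
qed

end

section \<open>Expansion of the increment of the functional\<close>

lemma abs_diff_bound:
  fixes u v z a b c :: real
  assumes "\<bar>u\<bar> \<le> a" "a \<le> b" "\<bar>v\<bar> \<le> c" "z = u - v"
  shows "\<bar>z\<bar> \<le> b + c"
  using assms by linarith

text \<open>The left side is the integral of the Taylor polynomials over both pieces; terms such as
  \<open>e - e\<close> mirror the antiderivative at its upper limit. The hypothesis on
  \<open>c\<close> removes the term linear in \<open>e\<close>. The factor
  \<open>(1 - lam)\<^sup>2 * (2 * lam + 1)\<close> arises from integrating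
  \<open>\<tau> * (\<tau> - e)\<close> over \<tau> from \<open>lam * e\<close> to
  \<open>e\<close>.\<close>

lemma expansion_algebra:
  fixes \<beta> a b g a' b' k b2 c2 lam c e :: real
  assumes "c * (lam - 1) = lam"
  shows "\<beta> * (lam * e) + a / 2 * (lam * e)\<^sup>2 + b / 3 * (lam * e) ^ 3
    + ((c * \<beta> * e + a' / 2 * e\<^sup>2 + b' / 6 * e ^ 3 + c * k * (e - e)\<^sup>2 / 2 + c * b2 * (e ^ 3 / 3 - e * e\<^sup>2 / 2) + c\<^sup>2 * c2 * (e - e) ^ 3 / 6)
    - (c * \<beta> * (lam * e) + a' / 2 * (lam * e)\<^sup>2 + b' / 6 * (lam * e) ^ 3 + c * k * (lam * e - e)\<^sup>2 / 2
       + c * b2 * ((lam * e) ^ 3 / 3 - e * (lam * e)\<^sup>2 / 2) + c\<^sup>2 * c2 * (lam * e - e) ^ 3 / 6))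
   = e\<^sup>2 / 2 * (lam\<^sup>2 * a + (1 - lam\<^sup>2) * a' - c * (1 - lam)\<^sup>2 * k)
     + e ^ 3 / 6 * (2 * lam ^ 3 * b + (1 - lam ^ 3) * b' - c * (1 - lam)\<^sup>2 * (2 * lam + 1) * b2 + c\<^sup>2 * (1 - lam) ^ 3 * c2)" (is "?lhs = ?rhs")
proof -
  have "\<beta> * (lam * e) + c * \<beta> * e - c * \<beta> * (lam * e) = \<beta> * e * (lam - c * (lam - 1))"
    by (simp add: algebra_simps)
  then have "\<beta> * (lam * e) + c * \<beta> * e - c * \<beta> * (lam * e) = 0" (is "?z = 0") using assms by simp
  moreover have "?lhs - ?z = ?rhs"
    by (simp add: power2_eq_square power3_eq_cube field_simps)
  ultimately show ?thesis by simp
qed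

context minimizing_arc
begin

text \<open>The Taylor errors are of order \<open>\<kappa> * e\<^sup>2\<close> on segments no longer
  than \<open>\<bar>e\<bar>\<close>. The common factor \<open>e\<close> in the conclusion stands for
  the sign of \<open>e\<close>: it makes one inequality valid on both sides of \<theta> and turns
  the error into a multiple of \<open>e ^ 4\<close>. The number \<beta> is the value of
  \<open>L_xdot \<bullet> \<eta>\<close>, and \<open>val\<close> expresses that both excess terms
  vanish.\<close>

lemma variation_expansion:
  assumes \<theta>: "\<theta> \<in> {p..q}" and lam: "0 < lam" "lam < 1" and c: "c * (lam - 1) = lam"
    and A2: "(A' 0 has_real_derivative \<alpha>0) (at \<theta> within {p..q})"
      "(A' \<eta> has_real_derivative \<alpha>1) (at \<theta> within {p..q})"
      "(A' (c *\<^sub>R \<eta>) has_real_derivative \<alpha>2) (at \<theta> within {p..q})"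
    and B1: "(B \<eta> \<eta> has_real_derivative \<beta>1) (at \<theta> within {p..q})"
      "(B \<eta> (c *\<^sub>R \<eta>) has_real_derivative \<beta>2) (at \<theta> within {p..q})"
    and val: "A \<eta> \<theta> - A 0 \<theta> = \<beta>" "A (c *\<^sub>R \<eta>) \<theta> - A 0 \<theta> = c * \<beta>"
    and "\<epsilon> > 0"
  defines "w \<equiv> lam\<^sup>2 * (A' \<eta> \<theta> - A' 0 \<theta> + B \<eta> \<eta> \<theta>) + (1 - lam\<^sup>2) * (A' (c *\<^sub>R \<eta>) \<theta> - A' 0 \<theta>)
      - c * (1 - lam)\<^sup>2 * B \<eta> (c *\<^sub>R \<eta>) \<theta>"
    and "g \<equiv> 2 * lam ^ 3 * ((\<alpha>1 - \<alpha>0) / 2 + \<beta>1 + C \<eta> \<eta> \<theta> / 2) + (1 - lam ^ 3) * (\<alpha>2 - \<alpha>0)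
      - c * (1 - lam)\<^sup>2 * (2 * lam + 1) * \<beta>2 + c\<^sup>2 * (1 - lam) ^ 3 * C \<eta> (c *\<^sub>R \<eta>) \<theta>"
  obtains d where "d > 0" "\<And>e. \<theta> + e \<in> {p..q} \<Longrightarrow> \<bar>e\<bar> < d \<Longrightarrow> e * (e\<^sup>2 / 2 * w + e ^ 3 / 6 * g) + \<epsilon> * e ^ 4 \<ge> 0"
proof -
  \<comment> \<open>The first piece contributes \<open>3 * \<kappa>\<close>: two from the mixed
    expansion and one from the expansion of \<open>A 0\<close>. The second contributes
    \<open>(2 + c\<^sup>2) * \<kappa>\<close>, its deviation being at most
    \<open>\<bar>c\<bar> * \<bar>e\<bar>\<close>.\<close>
  define \<kappa> where "\<kappa> = \<epsilon> / (5 + c\<^sup>2)"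
  have pos: "5 + c\<^sup>2 > 0" by (smt (verit) zero_le_power2)
  have \<kappa>: "\<kappa> > 0" "\<kappa> * (5 + c\<^sup>2) = \<epsilon>" using \<open>\<epsilon> > 0\<close> pos by (auto simp: \<kappa>_def)
  obtain d0 where d0: "d0 > 0" "\<And>t. t \<in> {p..q} \<Longrightarrow> \<bar>t - \<theta>\<bar> < d0 \<Longrightarrow>
      \<bar>A 0 t - (A 0 \<theta> + A' 0 \<theta> * (t - \<theta>) + \<alpha>0 / 2 * (t - \<theta>)\<^sup>2)\<bar> \<le> \<kappa> * (t - \<theta>)\<^sup>2"
    using Taylor2_Peano[OF convex_real_interval(5) \<theta> A_deriv A2(1) \<kappa>(1)] by blast
  obtain d1 where d1: "d1 > 0" "\<And>t s. t \<in> {p..q} \<Longrightarrow> \<bar>t - \<theta>\<bar> < d1 \<Longrightarrow> \<bar>s\<bar> < d1 \<Longrightarrow>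
    \<bar>L t (x t + s *\<^sub>R \<eta>) (x' t + \<eta>) - (A \<eta> \<theta> + A' \<eta> \<theta> * (t - \<theta>) + \<alpha>1 / 2 * (t - \<theta>)\<^sup>2 + s * B \<eta> \<eta> \<theta>
      + s * (t - \<theta>) * \<beta>1 + C \<eta> \<eta> \<theta> / 2 * s\<^sup>2)\<bar> \<le> \<kappa> * ((t - \<theta>)\<^sup>2 + s\<^sup>2)"
    using Taylor_mixed[OF \<theta> A2(2) B1(1) \<kappa>(1)] by blast
  obtain d2 where d2: "d2 > 0" "\<And>t s. t \<in> {p..q} \<Longrightarrow> \<bar>t - \<theta>\<bar> < d2 \<Longrightarrow> \<bar>s\<bar> < d2 \<Longrightarrow>
    \<bar>L t (x t + s *\<^sub>R \<eta>) (x' t + c *\<^sub>R \<eta>) - (A (c *\<^sub>R \<eta>) \<theta> + A' (c *\<^sub>R \<eta>) \<theta> * (t - \<theta>) + \<alpha>2 / 2 * (t - \<theta>)\<^sup>2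
      + s * B \<eta> (c *\<^sub>R \<eta>) \<theta> + s * (t - \<theta>) * \<beta>2 + C \<eta> (c *\<^sub>R \<eta>) \<theta> / 2 * s\<^sup>2)\<bar> \<le> \<kappa> * ((t - \<theta>)\<^sup>2 + s\<^sup>2)"
    using Taylor_mixed[OF \<theta> A2(3) B1(2) \<kappa>(1)] by blast
  \<comment> \<open>The third bound serves both the time increment and the deviation, of size
    \<open>\<bar>c\<bar> * \<bar>e\<bar>\<close>, on the second piece. The last one keeps the
    competitor within \<delta>, with 1 added against division by zero.\<close>
  define d where "d = min (min d0 d1) (min (d2 / (1 + \<bar>c\<bar>)) (\<delta> / (norm \<eta> + 1)))"
  have "norm \<eta> + 1 > 0" by (simp add: add_nonneg_pos)
  then have "d > 0" using d0(1) d1(1) d2(1) \<delta> by (auto simp: d_def)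
  show thesis
  proof (rule that[OF \<open>d > 0\<close>])
    fix e assume e: "\<theta> + e \<in> {p..q}" "\<bar>e\<bar> < d"
    show "e * (e\<^sup>2 / 2 * w + e ^ 3 / 6 * g) + \<epsilon> * e ^ 4 \<ge> 0"
    proof (cases "e = 0")
      case False
      have e0: "\<bar>e\<bar> < d0" and e1: "\<bar>e\<bar> < d1" using e by (auto simp: d_def)
      have e2: "\<bar>e\<bar> * (1 + \<bar>c\<bar>) < d2" using e by (simp add: d_def pos_less_divide_eq)
      have e3: "\<bar>e\<bar> * norm \<eta> \<le> \<delta>"
      proof -
        have "\<bar>e\<bar> * (norm \<eta> + 1) < \<delta>"
          using e \<open>norm \<eta> + 1 > 0\<close> by (simp add: d_def pos_less_divide_eq)
        then show ?thesis by (simp add: algebra_simps)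
      qed
      define r where "r = \<theta> + lam * e"
      define g1 where "g1 t = L t (x t + (1 * (t - \<theta>)) *\<^sub>R \<eta>) (x' t + 1 *\<^sub>R \<eta>) - L t (x t) (x' t)" for t
      define g2 where "g2 t = L t (x t + (c * (t - (\<theta> + e))) *\<^sub>R \<eta>) (x' t + c *\<^sub>R \<eta>) - L t (x t) (x' t)" for t
      have "continuous_on {p..q} g1" "continuous_on {p..q} g2" unfolding g1_def g2_def
        by (intro continuous_intros L_comp_cont x_cont x'_cont in_T; assumption)+
      then obtain \<Gamma>1 \<Gamma>2 where
        \<Gamma>1: "\<And>t. t \<in> {p..q} \<Longrightarrow> (\<Gamma>1 has_vector_derivative g1 t) (at t within {p..q})" and
        \<Gamma>2: "\<And>t. t \<in> {p..q} \<Longrightarrow> (\<Gamma>2 has_vector_derivative g2 t) (at t within {p..q})"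
        using antiderivative_continuous by metis
      \<comment> \<open>For \<open>e > 0\<close> this is the increment of the functional, for
        \<open>e < 0\<close> its negative; in both cases \<open>e * X\<close> is
        nonnegative.\<close>
      define X where "X = \<Gamma>1 r - \<Gamma>1 \<theta> + (\<Gamma>2 (\<theta> + e) - \<Gamma>2 r)"
      have ce: "c * (r - (\<theta> + e)) = lam * e"
      proof -
        have "c * (r - (\<theta> + e)) = c * (lam - 1) * e" by (simp add: r_def algebra_simps)
        then show ?thesis using c by simp
      qed
      have le: "lam * \<bar>e\<bar> * norm \<eta> \<le> \<delta>"
      proof -
        have "lam * (\<bar>e\<bar> * norm \<eta>) \<le> 1 * (\<bar>e\<bar> * norm \<eta>)" by (rule mult_right_mono) (use lam in auto)
        then show ?thesis using e3 by simp
      qed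
      have "e * X \<ge> 0"
      proof (cases "e > 0")
        case True
        have "X \<ge> 0" unfolding X_def
        proof (rule two_slope_variation[where a = \<theta> and b = "\<theta> + e" and ?c1.0 = 1 and ?c2.0 = c and \<eta> = \<eta>])
          show "\<theta> < r" "r < \<theta> + e" using lam True by (auto simp: r_def)
          show "1 * (r - \<theta>) = c * (r - (\<theta> + e))" using ce by (simp add: r_def)
          show "\<bar>1\<bar> * (r - \<theta>) * norm \<eta> \<le> \<delta>" using le True by (simp add: r_def)
        qed (use \<theta> e \<Gamma>1 \<Gamma>2 in \<open>auto simp: g1_def g2_def\<close>)
        then show ?thesis using True by simp
      next
        \<comment> \<open>Read from left to right, the interval now begins at
          \<open>\<theta> + e\<close>, so slope \<open>c\<close> comes first and slope 1
          second.\<close>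
        case neg: False
        have "\<Gamma>2 r - \<Gamma>2 (\<theta> + e) + (\<Gamma>1 \<theta> - \<Gamma>1 r) \<ge> 0"
        proof (rule two_slope_variation[where a = "\<theta> + e" and b = \<theta> and ?c1.0 = c and ?c2.0 = 1 and \<eta> = \<eta>])
          show "r < \<theta>" using lam neg False by (simp add: r_def mult_pos_neg)
          have "lam * e > 1 * e" by (rule mult_strict_right_mono_neg) (use lam neg False in auto)
          then show "\<theta> + e < r" by (simp add: r_def)
          then have "\<bar>c\<bar> * (r - (\<theta> + e)) = \<bar>lam * e\<bar>" using ce by (metis abs_mult abs_of_pos diff_gt_0_iff_gt)
          then show "\<bar>c\<bar> * (r - (\<theta> + e)) * norm \<eta> \<le> \<delta>" using le lam by (simp add: abs_mult)
          show "c * (r - (\<theta> + e)) = 1 * (r - \<theta>)" using ce by (simp add: r_def)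
        qed (use \<theta> e \<Gamma>1 \<Gamma>2 in \<open>auto simp: g1_def g2_def\<close>)
        then have "X \<le> 0" by (simp add: X_def)
        then show ?thesis using neg by (simp add: mult_nonpos_nonpos)
      qed
      define a b a' b' where "a = A' \<eta> \<theta> - A' 0 \<theta> + B \<eta> \<eta> \<theta>" and "b = (\<alpha>1 - \<alpha>0) / 2 + \<beta>1 + C \<eta> \<eta> \<theta> / 2"
        and "a' = A' (c *\<^sub>R \<eta>) \<theta> - A' 0 \<theta>" and "b' = \<alpha>2 - \<alpha>0"
      \<comment> \<open>\<open>P1\<close> and \<open>P2\<close> are primitives of
        \<open>\<rho>1\<close> and \<open>\<rho>2\<close>, the Taylor polynomials of
        \<open>g1\<close> and \<open>g2\<close>. On the first piece the deviation equals
        \<open>t - \<theta>\<close>, so the pure and mixed second-order terms merge into the one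
        coefficient \<open>b\<close>.\<close>
      define P1 where "P1 t = \<beta> * (t - \<theta>) + a / 2 * (t - \<theta>)\<^sup>2 + b / 3 * (t - \<theta>) ^ 3" for t
      define P2 where "P2 t = c * \<beta> * (t - \<theta>) + a' / 2 * (t - \<theta>)\<^sup>2 + b' / 6 * (t - \<theta>) ^ 3
        + c * B \<eta> (c *\<^sub>R \<eta>) \<theta> * (t - \<theta> - e)\<^sup>2 / 2 + c * \<beta>2 * ((t - \<theta>) ^ 3 / 3 - e * (t - \<theta>)\<^sup>2 / 2)
        + c\<^sup>2 * C \<eta> (c *\<^sub>R \<eta>) \<theta> * (t - \<theta> - e) ^ 3 / 6" for t
      define \<rho>1 where "\<rho>1 t = \<beta> + a * (t - \<theta>) + b * (t - \<theta>)\<^sup>2" for t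
      define \<rho>2 where "\<rho>2 t = c * \<beta> + a' * (t - \<theta>) + b' / 2 * (t - \<theta>)\<^sup>2 + (c * (t - \<theta> - e)) * B \<eta> (c *\<^sub>R \<eta>) \<theta>
        + (c * (t - \<theta> - e)) * (t - \<theta>) * \<beta>2 + C \<eta> (c *\<^sub>R \<eta>) \<theta> / 2 * (c * (t - \<theta> - e))\<^sup>2" for t
      have P1: "(P1 has_real_derivative \<rho>1 t) (at t)" for t unfolding P1_def \<rho>1_def
        by (auto intro!: derivative_eq_intros simp: power2_eq_square)
      have P2: "(P2 has_real_derivative \<rho>2 t) (at t)" for t unfolding P2_def \<rho>2_def
        by (rule derivative_eq_intros refl | simp)+ (simp add: power2_eq_square field_simps)
      have seg: "t \<in> {p..q} \<and> \<bar>t - \<theta>\<bar> \<le> \<bar>e\<bar> \<and> \<bar>t - \<theta> - e\<bar> \<le> \<bar>e\<bar>" if "t \<in> closed_segment \<theta> (\<theta> + e)" for t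
        using that \<theta> e(1) by (auto simp: closed_segment_eq_real_ivl split: if_splits)
      have "r = (1 - lam) *\<^sub>R \<theta> + lam *\<^sub>R (\<theta> + e)" by (simp add: r_def algebra_simps)
      then have r: "r \<in> closed_segment \<theta> (\<theta> + e)" using lam by (auto simp: closed_segment_def)
      have sub: "closed_segment \<theta> r \<subseteq> closed_segment \<theta> (\<theta> + e)" "closed_segment r (\<theta> + e) \<subseteq> closed_segment \<theta> (\<theta> + e)"
        using r by (simp_all add: subset_closed_segment)
      have sq: "y\<^sup>2 \<le> e\<^sup>2" if "\<bar>y\<bar> \<le> \<bar>e\<bar>" for y using that by (simp add: abs_le_square_iff)
      have A0: "\<bar>L t (x t) (x' t) - (A 0 \<theta> + A' 0 \<theta> * (t - \<theta>) + \<alpha>0 / 2 * (t - \<theta>)\<^sup>2)\<bar> \<le> \<kappa> * e\<^sup>2"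
        if t: "t \<in> closed_segment \<theta> (\<theta> + e)" for t
      proof -
        have "\<kappa> * (t - \<theta>)\<^sup>2 \<le> \<kappa> * e\<^sup>2" using sq[of "t - \<theta>"] seg[OF t] \<kappa>(1) by simp
        then show ?thesis using d0(2)[of t] seg[OF t] e0 by (simp add: A_def)
      qed
      have "\<bar>(\<Gamma>1 r - \<Gamma>1 \<theta>) - (P1 r - P1 \<theta>)\<bar> \<le> (3 * \<kappa> * e\<^sup>2) * \<bar>r - \<theta>\<bar>"
      proof (rule increment_bound[OF _ P1])
        fix t assume "t \<in> closed_segment \<theta> r"
        then have t: "t \<in> closed_segment \<theta> (\<theta> + e)" using sub by auto
        show "(\<Gamma>1 has_real_derivative g1 t) (at t within closed_segment \<theta> r)"
          unfolding has_real_derivative_iff_has_vector_derivative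
          by (rule has_vector_derivative_within_subset[OF \<Gamma>1]) (use seg sub t in blast)+
        let ?s = "t - \<theta>"
        have "\<bar>L t (x t + ?s *\<^sub>R \<eta>) (x' t + \<eta>) - (A \<eta> \<theta> + A' \<eta> \<theta> * (t - \<theta>) + \<alpha>1 / 2 * (t - \<theta>)\<^sup>2 + ?s * B \<eta> \<eta> \<theta>
          + ?s * (t - \<theta>) * \<beta>1 + C \<eta> \<eta> \<theta> / 2 * ?s\<^sup>2)\<bar> \<le> \<kappa> * ((t - \<theta>)\<^sup>2 + ?s\<^sup>2)"
          using d1(2)[of t ?s] seg[OF t] e1 by simp
        moreover have "\<kappa> * ((t - \<theta>)\<^sup>2 + ?s\<^sup>2) \<le> \<kappa> * (e\<^sup>2 + e\<^sup>2)"
          by (rule mult_left_mono) (use sq[of "t - \<theta>"] seg[OF t] \<kappa>(1) in auto)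
        moreover note A0[OF t]
        moreover have "g1 t - \<rho>1 t = (L t (x t + ?s *\<^sub>R \<eta>) (x' t + \<eta>) - (A \<eta> \<theta> + A' \<eta> \<theta> * (t - \<theta>) + \<alpha>1 / 2 * (t - \<theta>)\<^sup>2 + ?s * B \<eta> \<eta> \<theta>
          + ?s * (t - \<theta>) * \<beta>1 + C \<eta> \<eta> \<theta> / 2 * ?s\<^sup>2)) - (L t (x t) (x' t) - (A 0 \<theta> + A' 0 \<theta> * (t - \<theta>) + \<alpha>0 / 2 * (t - \<theta>)\<^sup>2))"
          unfolding g1_def \<rho>1_def a_def b_def val(1)[symmetric] by (simp add: algebra_simps power2_eq_square diff_divide_distrib add_divide_distrib)
        ultimately have "\<bar>g1 t - \<rho>1 t\<bar> \<le> \<kappa> * (e\<^sup>2 + e\<^sup>2) + \<kappa> * e\<^sup>2" by (rule abs_diff_bound)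
        then show "\<bar>g1 t - \<rho>1 t\<bar> \<le> 3 * \<kappa> * e\<^sup>2" by (simp add: algebra_simps)
      qed
      also have "\<dots> \<le> (3 * \<kappa> * e\<^sup>2) * \<bar>e\<bar>"
        by (rule mult_left_mono) (use seg[OF r] \<kappa>(1) in auto)
      finally have b1: "\<bar>(\<Gamma>1 r - \<Gamma>1 \<theta>) - (P1 r - P1 \<theta>)\<bar> \<le> (3 * \<kappa> * e\<^sup>2) * \<bar>e\<bar>" .
      have "\<bar>(\<Gamma>2 (\<theta> + e) - \<Gamma>2 r) - (P2 (\<theta> + e) - P2 r)\<bar> \<le> (\<kappa> * (2 + c\<^sup>2) * e\<^sup>2) * \<bar>\<theta> + e - r\<bar>"
      proof (rule increment_bound[OF _ P2])
        fix t assume "t \<in> closed_segment r (\<theta> + e)"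
        then have t: "t \<in> closed_segment \<theta> (\<theta> + e)" using sub by auto
        show "(\<Gamma>2 has_real_derivative g2 t) (at t within closed_segment r (\<theta> + e))"
          unfolding has_real_derivative_iff_has_vector_derivative
          by (rule has_vector_derivative_within_subset[OF \<Gamma>2]) (use seg sub t in blast)+
        let ?s = "c * (t - \<theta> - e)"
        have "\<bar>?s\<bar> \<le> \<bar>c\<bar> * \<bar>e\<bar>" using seg[OF t] by (simp add: abs_mult mult_left_mono)
        also have "\<dots> < d2" using e2 by (simp add: algebra_simps)
        finally have s: "\<bar>?s\<bar> < d2" .
        have "\<bar>t - \<theta>\<bar> < d2" using seg[OF t] e2 by (smt (verit) mult_nonneg_nonneg abs_ge_zero distrib_left mult_cancel_left1)
        then have "\<bar>L t (x t + ?s *\<^sub>R \<eta>) (x' t + c *\<^sub>R \<eta>) - (A (c *\<^sub>R \<eta>) \<theta> + A' (c *\<^sub>R \<eta>) \<theta> * (t - \<theta>) + \<alpha>2 / 2 * (t - \<theta>)\<^sup>2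
            + ?s * B \<eta> (c *\<^sub>R \<eta>) \<theta> + ?s * (t - \<theta>) * \<beta>2 + C \<eta> (c *\<^sub>R \<eta>) \<theta> / 2 * ?s\<^sup>2)\<bar> \<le> \<kappa> * ((t - \<theta>)\<^sup>2 + ?s\<^sup>2)"
          using d2(2)[of t ?s] seg[OF t] s by simp
        moreover have "\<kappa> * ((t - \<theta>)\<^sup>2 + ?s\<^sup>2) \<le> \<kappa> * (e\<^sup>2 + c\<^sup>2 * e\<^sup>2)"
          unfolding power_mult_distrib
          by (intro mult_left_mono add_mono) (use sq seg[OF t] \<kappa>(1) in auto)
        moreover note A0[OF t]
        moreover have "g2 t - \<rho>2 t = (L t (x t + ?s *\<^sub>R \<eta>) (x' t + c *\<^sub>R \<eta>) - (A (c *\<^sub>R \<eta>) \<theta> + A' (c *\<^sub>R \<eta>) \<theta> * (t - \<theta>) + \<alpha>2 / 2 * (t - \<theta>)\<^sup>2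
            + ?s * B \<eta> (c *\<^sub>R \<eta>) \<theta> + ?s * (t - \<theta>) * \<beta>2 + C \<eta> (c *\<^sub>R \<eta>) \<theta> / 2 * ?s\<^sup>2))
          - (L t (x t) (x' t) - (A 0 \<theta> + A' 0 \<theta> * (t - \<theta>) + \<alpha>0 / 2 * (t - \<theta>)\<^sup>2))"
        proof -
          have "t - (\<theta> + e) = t - \<theta> - e" by simp
          then show ?thesis
            unfolding g2_def \<rho>2_def a'_def b'_def val(2)[symmetric] by (simp add: algebra_simps diff_divide_distrib)
        qed
        ultimately have "\<bar>g2 t - \<rho>2 t\<bar> \<le> \<kappa> * (e\<^sup>2 + c\<^sup>2 * e\<^sup>2) + \<kappa> * e\<^sup>2" by (rule abs_diff_bound)
        then show "\<bar>g2 t - \<rho>2 t\<bar> \<le> \<kappa> * (2 + c\<^sup>2) * e\<^sup>2" by (simp add: algebra_simps)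
      qed
      also have "\<dots> \<le> (\<kappa> * (2 + c\<^sup>2) * e\<^sup>2) * \<bar>e\<bar>"
        by (rule mult_left_mono) (use seg[OF r] \<kappa>(1) in auto)
      finally have b2: "\<bar>(\<Gamma>2 (\<theta> + e) - \<Gamma>2 r) - (P2 (\<theta> + e) - P2 r)\<bar> \<le> (\<kappa> * (2 + c\<^sup>2) * e\<^sup>2) * \<bar>e\<bar>" .
      define Y where "Y = e\<^sup>2 / 2 * w + e ^ 3 / 6 * g"
      have "(P1 r - P1 \<theta>) + (P2 (\<theta> + e) - P2 r) = Y"
        using expansion_algebra[OF c, of \<beta> e a b a' b' "B \<eta> (c *\<^sub>R \<eta>) \<theta>" \<beta>2 "C \<eta> (c *\<^sub>R \<eta>) \<theta>"]
        by (simp add: Y_def w_def g_def P1_def P2_def a_def[symmetric] b_def[symmetric] a'_def[symmetric] b'_def[symmetric] r_def)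
      then have "\<bar>X - Y\<bar> \<le> (3 * \<kappa> * e\<^sup>2) * \<bar>e\<bar> + (\<kappa> * (2 + c\<^sup>2) * e\<^sup>2) * \<bar>e\<bar>"
        using b1 b2 unfolding X_def by linarith
      also have "\<dots> = \<kappa> * (5 + c\<^sup>2) * e\<^sup>2 * \<bar>e\<bar>" by (simp add: algebra_simps)
      finally have XY: "\<bar>X - Y\<bar> \<le> \<epsilon> * e\<^sup>2 * \<bar>e\<bar>" using \<kappa>(2) by simp
      have "\<bar>e * (X - Y)\<bar> \<le> \<bar>e\<bar> * (\<epsilon> * e\<^sup>2 * \<bar>e\<bar>)" unfolding abs_mult using XY by (rule mult_left_mono) simp
      also have "\<dots> = \<epsilon> * (e\<^sup>2 * \<bar>e\<bar>\<^sup>2)" unfolding power2_eq_square[of "\<bar>e\<bar>"] by (simp only: ac_simps)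
      also have "\<dots> = \<epsilon> * e ^ 4" by (simp flip: power_add)
      finally have "e * X - e * Y \<le> \<epsilon> * e ^ 4" by (simp add: right_diff_distrib)
      then show ?thesis using \<open>e * X \<ge> 0\<close> unfolding Y_def by linarith
    qed simp
  qed
qed

end

section \<open>Sign conditions extracted from the expansion\<close>

text \<open>With \<open>w = 0\<close> the inequality has the even factor \<open>e ^ 4\<close>, so
  one admissible sign of \<open>e\<close> is enough and \<theta> may be an end point. The other
  claim takes \<open>e\<close> of sign opposite to \<open>w\<close>, for which \<theta> must be
  interior.\<close>

lemma third_order_nonneg:
  fixes w g :: real
  assumes pq: "p < q" "\<theta> \<in> {p..q}"
    and exp: "\<And>\<epsilon>. \<epsilon> > 0 \<Longrightarrow> \<exists>d>0. \<forall>e. \<theta> + e \<in> {p..q} \<longrightarrow> \<bar>e\<bar> < d \<longrightarrow> e * (e\<^sup>2 / 2 * w + e ^ 3 / 6 * g) + \<epsilon> * e ^ 4 \<ge> 0"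
  shows "w = 0 \<Longrightarrow> g \<ge> 0" and "\<theta> \<in> {p<..<q} \<Longrightarrow> w = 0"
proof -
  show "g \<ge> 0" if "w = 0"
  proof (rule ccontr)
    assume "\<not> g \<ge> 0"
    \<comment> \<open>The choice \<open>- g / 12\<close> is half of \<open>- g / 6\<close>, so the
      total coefficient of \<open>e ^ 4\<close> is still the negative number
      \<open>g / 12\<close>.\<close>
    then obtain d where d: "d > 0" "\<And>e. \<theta> + e \<in> {p..q} \<Longrightarrow> \<bar>e\<bar> < d \<Longrightarrow> e * (e\<^sup>2 / 2 * w + e ^ 3 / 6 * g) + (- g / 12) * e ^ 4 \<ge> 0"
      using exp[of "- g / 12"] by auto
    obtain e where e: "e \<noteq> 0" "\<theta> + e \<in> {p..q}" "\<bar>e\<bar> < d"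
    proof (cases "\<theta> < q")
      case True
      then show ?thesis using that[of "min (d / 2) (q - \<theta>)"] d(1) pq by (auto simp: min_def split: if_splits)
    next
      case False
      then show ?thesis using that[of "- min (d / 2) (\<theta> - p)"] d(1) pq by (auto simp: min_def split: if_splits)
    qed
    have "e ^ 4 * (g / 12) \<ge> 0" using d(2)[OF e(2,3)] \<open>w = 0\<close> by (simp add: power4_eq_xxxx power3_eq_cube algebra_simps)
    then show False using e(1) \<open>\<not> g \<ge> 0\<close> by (simp add: zero_le_mult_iff)
  qed
  show "w = 0" if \<theta>: "\<theta> \<in> {p<..<q}"
  proof (rule ccontr)
    assume "w \<noteq> 0"
    obtain d where d: "d > 0" "\<And>e. \<theta> + e \<in> {p..q} \<Longrightarrow> \<bar>e\<bar> < d \<Longrightarrow> e * (e\<^sup>2 / 2 * w + e ^ 3 / 6 * g) + 1 * e ^ 4 \<ge> 0"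
      using exp[of 1] by auto
    define k where "k = \<bar>g\<bar> / 6 + 1"
    have k: "k > 0" by (simp add: k_def)
    \<comment> \<open>Since \<open>k\<close> dominates \<open>g / 6 + 1\<close>, the bound
      \<open>\<bar>w\<bar> / (4 * k)\<close> limits the higher-order term to
      \<open>h * \<bar>w\<bar> / 4\<close>, half the size of the leading term.\<close>
    define h where "h = min (min (d / 2) (\<bar>w\<bar> / (4 * k))) (min (\<theta> - p) (q - \<theta>))"
    have h: "h > 0" "h < d" "h \<le> \<bar>w\<bar> / (4 * k)" "h \<le> \<theta> - p" "h \<le> q - \<theta>"
      using d(1) \<theta> \<open>w \<noteq> 0\<close> k by (auto simp: h_def)
    define e where "e = - sgn w * h"
    have e: "\<bar>e\<bar> = h" "e * w = - \<bar>w\<bar> * h" using h(1) \<open>w \<noteq> 0\<close> by (auto simp: e_def sgn_if)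
    have "0 \<le> e * (e\<^sup>2 / 2 * w + e ^ 3 / 6 * g) + 1 * e ^ 4"
      by (rule d(2)) (use e(1) h in auto)
    also have "\<dots> = e\<^sup>2 * ((e * w) / 2 + e\<^sup>2 * (g / 6 + 1))"
      by (simp add: power4_eq_xxxx power3_eq_cube power2_eq_square algebra_simps)
    finally have "(e * w) / 2 + e\<^sup>2 * (g / 6 + 1) \<ge> 0" using h(1) e(1) by (auto simp: zero_le_mult_iff)
    moreover have "e\<^sup>2 * (g / 6 + 1) \<le> h\<^sup>2 * k" unfolding e(1)[symmetric] power2_abs
      by (rule mult_left_mono) (auto simp: k_def)
    moreover have "h\<^sup>2 * k \<le> h * (\<bar>w\<bar> / 4)"
    proof -
      have "h * k \<le> \<bar>w\<bar> / 4" using h(3) k by (simp add: field_simps)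
      then show ?thesis using h(1) by (simp add: power2_eq_square mult_left_mono)
    qed
    moreover have "\<bar>w\<bar> * h > 0" using h(1) \<open>w \<noteq> 0\<close> by simp
    ultimately show False unfolding e(2) by (simp add: algebra_simps)
  qed
qed

section \<open>The second-order condition\<close>

lemma has_field_derivative_transform:
  assumes "x \<in> S" "\<And>x. x \<in> S \<Longrightarrow> g x = f x" "(f has_field_derivative f') (at x within S)"
  shows "(g has_field_derivative f') (at x within S)"
  using assms unfolding has_field_derivative_def by (rule has_derivative_transform)

context minimizing_arc
begin

lemma L_x_inner:
  assumes "t \<in> T"
  shows "L_x L t y w \<bullet> h = f' (t, y, w) (0, h, 0)"
proof -
  have "((\<lambda>y. (t, y, w)) has_derivative (\<lambda>h. (0, h, 0))) (at y)"
    by (auto intro!: derivative_eq_intros)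
  from has_derivative_compose[OF this L_deriv[OF assms]]
  have "((\<lambda>y. L t y w) has_derivative (\<lambda>h. f' (t, y, w) (0, h, 0))) (at y)" by simp
  then show ?thesis unfolding L_x_def by (rule gradient_inner)
qed

lemma L_xdot_inner:
  assumes "t \<in> T"
  shows "L_xdot L t y w \<bullet> h = f' (t, y, w) (0, 0, h)"
proof -
  have "((\<lambda>w. (t, y, w)) has_derivative (\<lambda>h. (0, 0, h))) (at w)"
    by (auto intro!: derivative_eq_intros)
  from has_derivative_compose[OF this L_deriv[OF assms]]
  have "((\<lambda>w. L t y w) has_derivative (\<lambda>h. f' (t, y, w) (0, 0, h))) (at w)" by simp
  then show ?thesis unfolding L_xdot_def by (rule gradient_inner)
qed

text \<open>The Jacobian matrix represents a derivative only once the gradient \<open>L_x\<close> is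
  known to be differentiable. This holds componentwise, each \<open>L_x \<bullet> h\<close> being a
  value of \<open>f'\<close>; uniqueness of the derivative then gives the quadratic form.\<close>

lemma L_xx_quadratic:
  assumes "t \<in> T"
  shows "\<eta> \<bullet> (L_xx L t y w *v \<eta>) = f'' (t, y, w) (0, \<eta>, 0) (0, \<eta>, 0)"
proof -
  have der: "((\<lambda>y. L_x L t y w \<bullet> h) has_derivative (\<lambda>k. f'' (t, y, w) (0, k, 0) (0, h, 0))) (at y)" for h
  proof -
    have "((\<lambda>y. (t, y, w)) has_derivative (\<lambda>h. (0, h, 0))) (at y)"
      by (auto intro!: derivative_eq_intros)
    from has_derivative_compose[OF this f'_deriv[OF assms]]
    have "((\<lambda>y. f' (t, y, w)) has_derivative (\<lambda>k. f'' (t, y, w) (0, k, 0))) (at y)" .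
    from bounded_linear.has_derivative[OF blinfun.bounded_linear_left this, of "(0, h, 0)"]
    show ?thesis by (simp add: L_x_inner[OF assms])
  qed
  have "(\<lambda>y. L_x L t y w) differentiable (at y)"
    by (rule differentiable_componentwise_within[THEN iffD2, rule_format], rule differentiableI, rule der)
  then have "((\<lambda>y. L_x L t y w) has_derivative (\<lambda>k. L_xx L t y w *v k)) (at y)"
    unfolding L_xx_def jacobian_works .
  then have "((\<lambda>y. L_x L t y w \<bullet> \<eta>) has_derivative (\<lambda>k. (L_xx L t y w *v k) \<bullet> \<eta>)) (at y)"
    by (rule has_derivative_inner_left)
  then have "(\<lambda>k. (L_xx L t y w *v k) \<bullet> \<eta>) = (\<lambda>k. f'' (t, y, w) (0, k, 0) (0, \<eta>, 0))"
    using der by (rule has_derivative_unique)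
  from fun_cong[OF this, of \<eta>] show ?thesis by (simp add: inner_commute)
qed

text \<open>The operator \<open>D\<close> and the velocity \<open>v\<close> stay abstract, so that
  the right, left and two-sided conditions are instances. \<open>D\<close> is specified on a set
  \<open>U\<close> around \<theta> relative to \<open>{p..q}\<close>, not just at \<theta>, because
  \<open>G\<close> applies it twice.\<close>

lemma second_order_condition:
  assumes \<theta>: "\<theta> \<in> {p..q}" and lam: "lam \<in> {0<..<1}" and x''_deriv: "(x'' has_vector_derivative d) (at \<theta> within {p..q})"
    and v: "\<And>t. t \<in> {p..q} \<Longrightarrow> v t = x' t"
    and D: "\<And>t F m. t \<in> U \<Longrightarrow> (F has_real_derivative m) (at t within {p..q}) \<Longrightarrow> D F t = m"
    and U: "\<theta> \<in> U" "\<forall>\<^sub>F t in at \<theta> within {p..q}. t \<in> U" "U \<subseteq> {p..q}"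
    and E: "E L x v \<theta> \<eta> = 0" "E L x v \<theta> ((lam / (lam - 1)) *\<^sub>R \<eta>) = 0"
  shows "W D L x v \<theta> lam \<eta> = 0 \<Longrightarrow> G D L x v \<theta> lam \<eta> \<ge> 0"
    and "\<theta> \<in> {p<..<q} \<Longrightarrow> W D L x v \<theta> lam \<eta> = 0"
proof -
  define c where "c = lam / (lam - 1)"
  have lam': "0 < lam" "lam < 1" and c: "c * (lam - 1) = lam" using lam by (auto simp: c_def)
  obtain \<alpha>0 where \<alpha>0: "(A' 0 has_real_derivative \<alpha>0) (at \<theta> within {p..q})"
    using A'_deriv[OF \<theta> x''_deriv] by blast
  obtain \<alpha>1 where \<alpha>1: "(A' \<eta> has_real_derivative \<alpha>1) (at \<theta> within {p..q})"
    using A'_deriv[OF \<theta> x''_deriv] by blast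
  obtain \<alpha>2 where \<alpha>2: "(A' (c *\<^sub>R \<eta>) has_real_derivative \<alpha>2) (at \<theta> within {p..q})"
    using A'_deriv[OF \<theta> x''_deriv] by blast
  obtain \<beta>0 where \<beta>0: "(B \<eta> 0 has_real_derivative \<beta>0) (at \<theta> within {p..q})"
    using B_deriv[OF \<theta>] by blast
  obtain \<beta>1 where \<beta>1: "(B \<eta> \<eta> has_real_derivative \<beta>1) (at \<theta> within {p..q})"
    using B_deriv[OF \<theta>] by blast
  obtain \<beta>2 where \<beta>2: "(B \<eta> (c *\<^sub>R \<eta>) has_real_derivative \<beta>2) (at \<theta> within {p..q})"
    using B_deriv[OF \<theta>] by blast
  define l where "l t = f' (t, x t, x' t) (0, 0, \<eta>)" for t
  \<comment> \<open>The Euler equation is used on all of \<open>{p..q}\<close>: the derivative of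
    \<open>l\<close> is the function \<open>B \<eta> 0\<close>, so the second derivative of
    \<open>l\<close> at \<theta> is \<open>\<beta>0\<close>.\<close>
  have l: "(l has_real_derivative B \<eta> 0 t) (at t within {p..q})" if "t \<in> {p..q}" for t
    using euler_equation[OF that, of \<eta>] by (simp add: l_def[abs_def] B_def)
  have E_eq: "E L x v t \<eta> = A \<eta> t - A 0 t - l t" "E L x v t (c *\<^sub>R \<eta>) = A (c *\<^sub>R \<eta>) t - A 0 t - c * l t"
    if "t \<in> {p..q}" for t
    using v[OF that] L_xdot_inner[OF in_T[OF that]] by (auto simp: E_def A_def l_def)
  have Delta_eq: "Delta_L_x L x v t \<xi> \<bullet> \<eta> = B \<eta> \<xi> t - B \<eta> 0 t" if "t \<in> {p..q}" for t \<xi>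
    using v[OF that] L_x_inner[OF in_T[OF that]] by (simp add: Delta_L_x_def B_def inner_diff_left)
  have Q_eq: "Q i L x v t lam \<eta> = lam ^ i * (A \<eta> t - A 0 t - l t) + (1 - lam ^ i) * (A (c *\<^sub>R \<eta>) t - A 0 t - c * l t)"
    if "t \<in> {p..q}" for i t using E_eq[OF that] by (simp add: Q_def c_def)
  define Q' where "Q' i t = lam ^ i * (A' \<eta> t - A' 0 t - B \<eta> 0 t)
    + (1 - lam ^ i) * (A' (c *\<^sub>R \<eta>) t - A' 0 t - c * B \<eta> 0 t)" for i t
  have Q_deriv: "((\<lambda>t. Q i L x v t lam \<eta>) has_real_derivative Q' i t) (at t within {p..q})" if t: "t \<in> {p..q}" for i t
  proof (rule has_field_derivative_transform[OF t Q_eq])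
    show "((\<lambda>t. lam ^ i * (A \<eta> t - A 0 t - l t) + (1 - lam ^ i) * (A (c *\<^sub>R \<eta>) t - A 0 t - c * l t))
        has_real_derivative Q' i t) (at t within {p..q})"
      unfolding Q'_def by (intro DERIV_add DERIV_diff DERIV_cmult A_deriv l t)
  qed
  have DQ: "D (\<lambda>t. Q i L x v t lam \<eta>) t = Q' i t" if "t \<in> U" for i t
    using D[OF that Q_deriv] U(3) that by blast
  define q2 where "q2 = lam ^ 3 * (\<alpha>1 - \<alpha>0 - \<beta>0) + (1 - lam ^ 3) * (\<alpha>2 - \<alpha>0 - c * \<beta>0)"
  have DDQ: "D (D (\<lambda>t. Q 3 L x v t lam \<eta>)) \<theta> = q2"
  proof (rule D[OF U(1)])
    have "(Q' 3 has_real_derivative q2) (at \<theta> within {p..q})"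
      unfolding Q'_def q2_def by (intro DERIV_add DERIV_diff DERIV_cmult \<alpha>0 \<alpha>1 \<alpha>2 \<beta>0)
    \<comment> \<open>The inner application of \<open>D\<close> is known on \<open>U\<close> only,
      which is enough for the derivative at \<theta>.\<close>
    moreover have "\<forall>\<^sub>F t in at \<theta> within {p..q}. Q' 3 t = D (\<lambda>t. Q 3 L x v t lam \<eta>) t"
      using U(2) by (rule eventually_mono) (simp add: DQ)
    ultimately show "(D (\<lambda>t. Q 3 L x v t lam \<eta>) has_real_derivative q2) (at \<theta> within {p..q})"
      unfolding has_field_derivative_def
      by (rule has_derivative_transform_eventually) (use DQ U(1) \<theta> in auto)
  qed
  have M_eq: "M i L x v t lam \<eta> = lam ^ i * (B \<eta> \<eta> t - B \<eta> 0 t) +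
      (1 - lam) * (1/2 + lam) ^ (i - 1) * (B \<eta> (c *\<^sub>R \<eta>) t - B \<eta> 0 t)" if "t \<in> {p..q}" for i t
    using Delta_eq[OF that] by (simp add: M_def c_def)
  have DM: "D (\<lambda>t. M 2 L x v t lam \<eta>) \<theta> = lam\<^sup>2 * (\<beta>1 - \<beta>0) + (1 - lam) * (1/2 + lam) ^ (2 - 1) * (\<beta>2 - \<beta>0)"
  proof (rule D[OF U(1)], rule has_field_derivative_transform[OF \<theta> M_eq])
    show "((\<lambda>t. lam\<^sup>2 * (B \<eta> \<eta> t - B \<eta> 0 t) + (1 - lam) * (1/2 + lam) ^ (2 - 1) * (B \<eta> (c *\<^sub>R \<eta>) t - B \<eta> 0 t))
      has_real_derivative lam\<^sup>2 * (\<beta>1 - \<beta>0) + (1 - lam) * (1/2 + lam) ^ (2 - 1) * (\<beta>2 - \<beta>0)) (at \<theta> within {p..q})"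
      by (intro DERIV_add DERIV_diff DERIV_cmult \<beta>0 \<beta>1 \<beta>2)
  qed
  define w where "w = lam\<^sup>2 * (A' \<eta> \<theta> - A' 0 \<theta> + B \<eta> \<eta> \<theta>) + (1 - lam\<^sup>2) * (A' (c *\<^sub>R \<eta>) \<theta> - A' 0 \<theta>)
      - c * (1 - lam)\<^sup>2 * B \<eta> (c *\<^sub>R \<eta>) \<theta>"
  define g where "g = 2 * lam ^ 3 * ((\<alpha>1 - \<alpha>0) / 2 + \<beta>1 + C \<eta> \<eta> \<theta> / 2) + (1 - lam ^ 3) * (\<alpha>2 - \<alpha>0)
      - c * (1 - lam)\<^sup>2 * (2 * lam + 1) * \<beta>2 + c\<^sup>2 * (1 - lam) ^ 3 * C \<eta> (c *\<^sub>R \<eta>) \<theta>"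
  have z: "lam + c * (1 - lam) = 0" using c by (simp add: algebra_simps)
  \<comment> \<open>\<open>W\<close> involves \<open>B \<eta> 0\<close> through the Euler equation,
    while \<open>w\<close> does not. The discrepancy is a multiple of
    \<open>lam + c * (1 - lam)\<close>, which is zero.\<close>
  have "W D L x v \<theta> lam \<eta> - w = ((1 - lam) * B \<eta> (c *\<^sub>R \<eta>) \<theta> - (1 + lam) * B \<eta> 0 \<theta>) * (lam + c * (1 - lam))"
    unfolding W_def DQ[OF U(1)] M_eq[OF \<theta>] Q'_def w_def by (simp add: algebra_simps power2_eq_square)
  then have W_eq: "W D L x v \<theta> lam \<eta> = w" unfolding z by simp
  have Hess: "\<eta> \<bullet> ((lam *\<^sub>R L_xx L \<theta> (x \<theta>) (v \<theta> + \<eta>) + (1 - lam) *\<^sub>R L_xx L \<theta> (x \<theta>) (v \<theta> + (lam / (lam - 1)) *\<^sub>R \<eta>)) *v \<eta>)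
      = lam * C \<eta> \<eta> \<theta> + (1 - lam) * C \<eta> (c *\<^sub>R \<eta>) \<theta>"
    using L_xx_quadratic[OF in_T[OF \<theta>], of \<eta>] v[OF \<theta>]
    by (simp add: matrix_vector_mult_add_rdistrib scaleR_matrix_vector_assoc[symmetric] inner_add_right C_def c_def)
  \<comment> \<open>The same mechanism. The factor \<open>1/2 + lam\<close> in \<open>M 2\<close>,
    doubled, is the \<open>2 * lam + 1\<close> produced by the integration over the second
    piece.\<close>
  have "G D L x v \<theta> lam \<eta> - g = ((1 - lam) * (lam - c * (1 - lam)) * C \<eta> (c *\<^sub>R \<eta>) \<theta>
      + (1 - lam) * (2 * lam + 1) * \<beta>2 - (1 + lam + lam\<^sup>2) * \<beta>0) * (lam + c * (1 - lam))"
    unfolding G_def DDQ DM Hess q2_def g_def by (simp add: field_simps power2_eq_square power3_eq_cube)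
  then have G_eq: "G D L x v \<theta> lam \<eta> = g" unfolding z by simp
  have val: "A \<eta> \<theta> - A 0 \<theta> = l \<theta>" "A (c *\<^sub>R \<eta>) \<theta> - A 0 \<theta> = c * l \<theta>"
    using E E_eq[OF \<theta>] by (auto simp: c_def)
  have exp: "\<exists>d>0. \<forall>e. \<theta> + e \<in> {p..q} \<longrightarrow> \<bar>e\<bar> < d \<longrightarrow> e * (e\<^sup>2 / 2 * w + e ^ 3 / 6 * g) + \<epsilon> * e ^ 4 \<ge> 0"
    if "\<epsilon> > 0" for \<epsilon>
    using variation_expansion[OF \<theta> lam' c \<alpha>0 \<alpha>1 \<alpha>2 \<beta>1 \<beta>2 val that] unfolding w_def g_def by metis
  show "W D L x v \<theta> lam \<eta> = 0 \<Longrightarrow> G D L x v \<theta> lam \<eta> \<ge> 0"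
    "\<theta> \<in> {p<..<q} \<Longrightarrow> W D L x v \<theta> lam \<eta> = 0"
    unfolding W_eq G_eq using third_order_nonneg[OF pq(1) \<theta> exp] by blast+
qed

end

section \<open>From the minimizer on the whole interval to the three cases\<close>

text \<open>The derivatives of \<open>L\<close> come from \<open>C2_on\<close> and the radius
  \<delta> from localization; together they make \<open>x\<close> on \<open>{p..q}\<close> a
  minimizing arc.\<close>

lemma minimum_second_order_condition:
  fixes L :: "'n::finite lagrangian" and x :: "real \<Rightarrow> real^'n"
  assumes T: "{t0..t1} \<subseteq> T" "open T" and L: "C2_on (T \<times> UNIV \<times> UNIV) (\<lambda>(t, y, w). L t y w)"
    and min: "strong_local_min L t0 t1 x0 x1 x"
    and pq: "t0 \<le> p" "p < q" "q \<le> t1"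
    and x: "\<And>t. t \<in> {p..q} \<Longrightarrow> (x has_vector_derivative x' t) (at t within {p..q})"
      "\<And>t. t \<in> {p..q} \<Longrightarrow> (x' has_vector_derivative x'' t) (at t within {p..q})"
      "(x'' has_vector_derivative d) (at \<theta> within {p..q})"
    and \<theta>: "\<theta> \<in> {p..q}" and lam: "lam \<in> {0<..<1}"
    and v: "\<And>t. t \<in> {p..q} \<Longrightarrow> v t = x' t"
    and D: "\<And>t F m. t \<in> U \<Longrightarrow> (F has_real_derivative m) (at t within {p..q}) \<Longrightarrow> D F t = m"
    and U: "\<theta> \<in> U" "\<forall>\<^sub>F t in at \<theta> within {p..q}. t \<in> U" "U \<subseteq> {p..q}"
    and E: "E L x v \<theta> \<eta> = 0" "E L x v \<theta> ((inverse (lam - 1) * lam) *\<^sub>R \<eta>) = 0"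
  shows "W D L x v \<theta> lam \<eta> = 0 \<Longrightarrow> G D L x v \<theta> lam \<eta> \<ge> 0"
    and "\<theta> \<in> {p<..<q} \<Longrightarrow> W D L x v \<theta> lam \<eta> = 0"
proof -
  obtain f' f'' where
    f': "\<forall>z\<in>T \<times> UNIV \<times> UNIV. ((\<lambda>(t, y, w). L t y w) has_derivative blinfun_apply (f' z)) (at z)" and
    f'': "\<forall>z\<in>T \<times> UNIV \<times> UNIV. (f' has_derivative blinfun_apply (f'' z)) (at z)" "continuous_on (T \<times> UNIV \<times> UNIV) f''"
    using L unfolding C2_on_def C1_on_def by blast
  have "continuous_on (T \<times> UNIV \<times> UNIV) (\<lambda>(t, y, w). L t y w)"
    by (intro continuous_at_imp_continuous_on ballI) (use f' has_derivative_continuous in blast)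
  then have Lc: "continuous_on ({t0..t1} \<times> UNIV \<times> UNIV) (\<lambda>(t, y, w). L t y w)"
    by (rule continuous_on_subset) (use T in auto)
  obtain \<delta> where \<delta>: "\<delta> > 0"
    "\<And>p q y. t0 \<le> p \<Longrightarrow> p < q \<Longrightarrow> q \<le> t1 \<Longrightarrow> x \<in> KC1 p q \<Longrightarrow> y \<in> KC1 p q \<Longrightarrow> y p = x p \<Longrightarrow> y q = x q \<Longrightarrow>
       (\<And>t. t \<in> {p..q} \<Longrightarrow> norm (y t - x t) \<le> \<delta>) \<Longrightarrow> J L p q x \<le> J L p q y"
    using strong_local_min_local[OF min Lc] by blast
  interpret minimizing_arc L T f' f'' p q \<delta> x x' x''
  proof
    show "open T" "p < q" "{p..q} \<subseteq> T" using T pq by auto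
    show "((\<lambda>(t, y, w). L t y w) has_derivative f' (t, y, w)) (at (t, y, w))"
      "(f' has_derivative f'' (t, y, w)) (at (t, y, w))" if "t \<in> T" for t y w
      using f' f''(1) that by auto
    show "J L a b x \<le> J L a b y" if "p \<le> a" "a < b" "b \<le> q" "x \<in> KC1 a b" "y \<in> KC1 a b"
      "y a = x a" "y b = x b" "\<And>t. t \<in> {a..b} \<Longrightarrow> norm (y t - x t) \<le> \<delta>" for a b y
      by (rule \<delta>(2)) (use that pq in auto)
  qed (fact f''(2) x \<delta>(1))+
  have E': "E L x v \<theta> ((lam / (lam - 1)) *\<^sub>R \<eta>) = 0" using E(2) by (simp add: divide_inverse mult.commute)
  note condition = second_order_condition[where v = v and D = D and U = U, OF \<theta> lam x(3)]
  show "G D L x v \<theta> lam \<eta> \<ge> 0" if "W D L x v \<theta> lam \<eta> = 0"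
    by (rule condition(1)) (fact v D U E(1) E' that)+
  show "W D L x v \<theta> lam \<eta> = 0" if "\<theta> \<in> {p<..<q}"
    by (rule condition(2)) (fact v D U E(1) E' that)+
qed

lemma velocity_interior:
  assumes "t \<in> {a<..<b}" "(x has_vector_derivative v) (at t)"
  shows "velocity a b x t = v"
  by (rule velocity_eqI) (use assms in \<open>auto intro: has_vector_derivative_at_within\<close>)

text \<open>On the open interval to the right of \<open>t\<close> the velocity is \<open>x'\<close>,
  so its right limit is that of \<open>x'\<close>. The identity is needed at every \<open>t\<close>
  near \<theta>, since \<open>deriv_right\<close> differentiates expressions containing the whole
  curve \<open>velocity_right\<close>.\<close>

lemma velocity_right_eq:
  assumes "t < b" "{t<..<b} \<subseteq> {t0<..<t1}" "\<And>s. s \<in> {t<..<b} \<Longrightarrow> (x has_vector_derivative x' s) (at s)"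
    "(x' \<longlongrightarrow> x' t) (at_right t)"
  shows "velocity_right t0 t1 x t = x' t"
proof -
  have "x' s = velocity t0 t1 x s" if "s \<in> {t<..<b}" for s
    by (rule velocity_interior[symmetric, OF subsetD[OF assms(2) that] assms(3)[OF that]])
  then have "\<forall>\<^sub>F s in at_right t. x' s = velocity t0 t1 x s"
    using assms(1) unfolding eventually_at_right_field by auto
  then have "(velocity t0 t1 x \<longlongrightarrow> x' t) (at_right t)"
    using assms(4) by (simp add: tendsto_cong)
  then show ?thesis unfolding velocity_right_def by (intro tendsto_Lim) auto
qed

lemma velocity_left_eq:
  assumes "a < t" "{a<..<t} \<subseteq> {t0<..<t1}" "\<And>s. s \<in> {a<..<t} \<Longrightarrow> (x has_vector_derivative x' s) (at s)"
    "(x' \<longlongrightarrow> x' t) (at_left t)"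
  shows "velocity_left t0 t1 x t = x' t"
proof -
  have "x' s = velocity t0 t1 x s" if "s \<in> {a<..<t}" for s
    by (rule velocity_interior[symmetric, OF subsetD[OF assms(2) that] assms(3)[OF that]])
  then have "\<forall>\<^sub>F s in at_left t. x' s = velocity t0 t1 x s"
    using assms(1) unfolding eventually_at_left_field by auto
  then have "(velocity t0 t1 x \<longlongrightarrow> x' t) (at_left t)"
    using assms(4) by (simp add: tendsto_cong)
  then show ?thesis unfolding velocity_left_def by (intro tendsto_Lim) auto
qed

text \<open>At \<open>t = q\<close> the derivative within \<open>{p..q}\<close> would be a left
  derivative, which is why \<open>q\<close> is excluded.\<close>

lemma deriv_right_eq:
  assumes "(F has_real_derivative m) (at t within {p..q})" "t \<in> {p..<q}"
  shows "deriv_right F t = m"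
proof -
  have "(F has_real_derivative m) (at t within {t..q})"
    by (rule has_field_derivative_subset[OF assms(1)]) (use assms(2) in auto)
  then have "(F has_vector_derivative m) (at_right t)"
    using assms(2) by (simp add: at_within_Icc_at_right has_real_derivative_iff_has_vector_derivative)
  then show ?thesis unfolding deriv_right_def by (intro vector_derivative_within) auto
qed

lemma deriv_left_eq:
  assumes "(F has_real_derivative m) (at t within {p..q})" "t \<in> {p<..q}"
  shows "deriv_left F t = m"
proof -
  have "(F has_real_derivative m) (at t within {p..t})"
    by (rule has_field_derivative_subset[OF assms(1)]) (use assms(2) in auto)
  then have "(F has_vector_derivative m) (at_left t)"
    using assms(2) by (simp add: at_within_Icc_at_left has_real_derivative_iff_has_vector_derivative)
  then show ?thesis unfolding deriv_left_def by (intro vector_derivative_within) auto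
qed

lemma thrice_differentiable_onE:
  assumes "thrice_differentiable_on x S"
  obtains x' x'' x''' where "\<And>t. t \<in> S \<Longrightarrow> (x has_vector_derivative x' t) (at t within S)"
    "\<And>t. t \<in> S \<Longrightarrow> (x' has_vector_derivative x'' t) (at t within S)"
    "\<And>t. t \<in> S \<Longrightarrow> (x'' has_vector_derivative x''' t) (at t within S)"
  using assms unfolding thrice_differentiable_on_def by metis

theorem theorem3p2:
  fixes a b :: ereal and t0 t1 :: real
    and L :: "'n::finite lagrangian"
    and x0 x1 :: "real^'n" and xb :: "real \<Rightarrow> real^'n"
  assumes "t0 < t1" and "{t0..t1} \<subseteq> einterval a b"
    and "C2_on (einterval a b \<times> UNIV \<times> UNIV) (\<lambda>(t, y, w). L t y w)"
    and "C2_on (einterval a b \<times> UNIV \<times> UNIV) (\<lambda>(t, y, w). L_xdot L t y w)"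
    and "strong_local_min L t0 t1 x0 x1 xb"
  shows
    "(\<forall>\<theta>\<in>{t0..<t1}. \<forall>\<alpha>>0. \<forall>\<eta> lam.
        {\<theta>..<\<theta>+\<alpha>} \<subseteq> {t0..t1} \<and> thrice_differentiable_on xb {\<theta>..<\<theta>+\<alpha>} \<and>
        \<eta> \<noteq> 0 \<and> lam \<in> {0<..<1} \<and>
        E L xb (velocity_right t0 t1 xb) \<theta> \<eta> = 0 \<and>
        E L xb (velocity_right t0 t1 xb) \<theta> ((inverse (lam - 1) * lam) *\<^sub>R \<eta>) = 0 \<and>
        W deriv_right L xb (velocity_right t0 t1 xb) \<theta> lam \<eta> = 0
        \<longrightarrow> G deriv_right L xb (velocity_right t0 t1 xb) \<theta> lam \<eta> \<ge> 0) \<and>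
     (\<forall>\<theta>\<in>{t0<..t1}. \<forall>\<alpha>>0. \<forall>\<eta> lam.
        {\<theta>-\<alpha><..\<theta>} \<subseteq> {t0..t1} \<and> thrice_differentiable_on xb {\<theta>-\<alpha><..\<theta>} \<and>
        \<eta> \<noteq> 0 \<and> lam \<in> {0<..<1} \<and>
        E L xb (velocity_left t0 t1 xb) \<theta> \<eta> = 0 \<and>
        E L xb (velocity_left t0 t1 xb) \<theta> ((inverse (lam - 1) * lam) *\<^sub>R \<eta>) = 0 \<and>
        W deriv_left L xb (velocity_left t0 t1 xb) \<theta> lam \<eta> = 0
        \<longrightarrow> G deriv_left L xb (velocity_left t0 t1 xb) \<theta> lam \<eta> \<ge> 0) \<and>
     (\<forall>\<theta>\<in>{t0<..<t1}. \<forall>\<eta> lam.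
        thrice_differentiable_at xb \<theta> \<and>
        \<eta> \<noteq> 0 \<and> lam \<in> {0<..<1} \<and>
        E L xb (velocity t0 t1 xb) \<theta> \<eta> = 0 \<and>
        E L xb (velocity t0 t1 xb) \<theta> ((inverse (lam - 1) * lam) *\<^sub>R \<eta>) = 0
        \<longrightarrow> G deriv L xb (velocity t0 t1 xb) \<theta> lam \<eta> \<ge> 0)"
proof (intro conjI ballI allI impI; elim conjE)
  note cond = minimum_second_order_condition[OF assms(2) open_einterval assms(3,5)]
  {
    fix \<theta> \<alpha> \<eta> lam
    assume \<theta>: "\<theta> \<in> {t0..<t1}" "\<alpha> > 0" and S: "{\<theta>..<\<theta>+\<alpha>} \<subseteq> {t0..t1}" and diff: "thrice_differentiable_on xb {\<theta>..<\<theta>+\<alpha>}"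
      and lam: "lam \<in> {0<..<1}"
      and EW: "E L xb (velocity_right t0 t1 xb) \<theta> \<eta> = 0"
        "E L xb (velocity_right t0 t1 xb) \<theta> ((inverse (lam - 1) * lam) *\<^sub>R \<eta>) = 0"
        "W deriv_right L xb (velocity_right t0 t1 xb) \<theta> lam \<eta> = 0"
    obtain x' x'' x''' where x: "\<And>t. t \<in> {\<theta>..<\<theta>+\<alpha>} \<Longrightarrow> (xb has_vector_derivative x' t) (at t within {\<theta>..<\<theta>+\<alpha>})"
      "\<And>t. t \<in> {\<theta>..<\<theta>+\<alpha>} \<Longrightarrow> (x' has_vector_derivative x'' t) (at t within {\<theta>..<\<theta>+\<alpha>})"
      "\<And>t. t \<in> {\<theta>..<\<theta>+\<alpha>} \<Longrightarrow> (x'' has_vector_derivative x''' t) (at t within {\<theta>..<\<theta>+\<alpha>})"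
      using thrice_differentiable_onE[OF diff] by metis
    \<comment> \<open>A closed interval inside the half-open one, so that derivatives are also
      available at its right end.\<close>
    define q where "q = \<theta> + \<alpha> / 2"
    have q: "\<theta> < q" "q < \<theta> + \<alpha>" "q \<in> {\<theta>..<\<theta>+\<alpha>}" using \<theta> by (auto simp: q_def)
    have sub: "{\<theta>..q} \<subseteq> {\<theta>..<\<theta>+\<alpha>}" using q by auto
    \<comment> \<open>Away from \<theta> the half-open interval is a neighbourhood of
      \<open>s\<close>, so the derivative within it is two-sided.\<close>
    have xi: "(xb has_vector_derivative x' s) (at s)" if "s \<in> {\<theta><..<\<theta>+\<alpha>}" for s
    proof -
      have "(xb has_vector_derivative x' s) (at s within {\<theta><..<\<theta>+\<alpha>})"
        by (rule has_vector_derivative_within_subset[OF x(1)]) (use that in auto)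
      then show ?thesis by (simp only: at_within_open[OF that open_greaterThanLessThan])
    qed
    have v: "velocity_right t0 t1 xb t = x' t" if t: "t \<in> {\<theta>..q}" for t
    proof (rule velocity_right_eq)
      show "t < \<theta> + \<alpha>" using t q by auto
      have "{t<..<\<theta>+\<alpha>} \<subseteq> interior {t0..t1}" using S t by (intro interior_maximal) auto
      then show "{t<..<\<theta>+\<alpha>} \<subseteq> {t0<..<t1}" by simp
      show "(xb has_vector_derivative x' s) (at s)" if "s \<in> {t<..<\<theta>+\<alpha>}" for s
        by (rule xi) (use that t in auto)
      have "(x' \<longlongrightarrow> x' t) (at t within {\<theta>..<\<theta>+\<alpha>})"
        using has_vector_derivative_continuous[OF x(2)[of t]] t sub by (auto simp: continuous_within)
      \<comment> \<open>The midpoint of \<open>q\<close> and \<open>\<theta> + \<alpha>\<close> lies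
        to the right of \<open>t\<close> even for \<open>t = q\<close>, and still inside the
        interval of differentiability.\<close>
      then have "(x' \<longlongrightarrow> x' t) (at t within {t..(q + \<theta> + \<alpha>) / 2})"
        by (rule tendsto_within_subset) (use t q in auto)
      then show "(x' \<longlongrightarrow> x' t) (at_right t)"
        using t q by (simp add: at_within_Icc_at_right)
    qed
    show "G deriv_right L xb (velocity_right t0 t1 xb) \<theta> lam \<eta> \<ge> 0"
    \<comment> \<open>\<open>U\<close> omits \<open>q\<close>, where a right derivative depends on
      values outside \<open>{\<theta>..q}\<close>.\<close>
    proof (rule cond(1)[where p = \<theta> and q = q and x' = x' and x'' = x'' and U = "{\<theta>..<q}"])
      show "q \<le> t1" using S q(3) by auto
      show "(xb has_vector_derivative x' t) (at t within {\<theta>..q})"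
        "(x' has_vector_derivative x'' t) (at t within {\<theta>..q})" if "t \<in> {\<theta>..q}" for t
        by (rule has_vector_derivative_within_subset[OF x(1) sub], use that sub in blast,
            rule has_vector_derivative_within_subset[OF x(2) sub], use that sub in blast)
      show "(x'' has_vector_derivative x''' \<theta>) (at \<theta> within {\<theta>..q})"
        by (rule has_vector_derivative_within_subset[OF x(3) sub]) (use q in auto)
      show "\<forall>\<^sub>F t in at \<theta> within {\<theta>..q}. t \<in> {\<theta>..<q}"
        using q(1) by (auto simp: at_within_Icc_at_right eventually_at_right_field intro: exI[of _ q])
    qed (use \<theta> q lam EW v deriv_right_eq in auto)
  next
    fix \<theta> \<alpha> \<eta> lam
    assume \<theta>: "\<theta> \<in> {t0<..t1}" "\<alpha> > 0" and S: "{\<theta>-\<alpha><..\<theta>} \<subseteq> {t0..t1}" and diff: "thrice_differentiable_on xb {\<theta>-\<alpha><..\<theta>}"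
      and lam: "lam \<in> {0<..<1}"
      and EW: "E L xb (velocity_left t0 t1 xb) \<theta> \<eta> = 0"
        "E L xb (velocity_left t0 t1 xb) \<theta> ((inverse (lam - 1) * lam) *\<^sub>R \<eta>) = 0"
        "W deriv_left L xb (velocity_left t0 t1 xb) \<theta> lam \<eta> = 0"
    obtain x' x'' x''' where x: "\<And>t. t \<in> {\<theta>-\<alpha><..\<theta>} \<Longrightarrow> (xb has_vector_derivative x' t) (at t within {\<theta>-\<alpha><..\<theta>})"
      "\<And>t. t \<in> {\<theta>-\<alpha><..\<theta>} \<Longrightarrow> (x' has_vector_derivative x'' t) (at t within {\<theta>-\<alpha><..\<theta>})"
      "\<And>t. t \<in> {\<theta>-\<alpha><..\<theta>} \<Longrightarrow> (x'' has_vector_derivative x''' t) (at t within {\<theta>-\<alpha><..\<theta>})"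
      using thrice_differentiable_onE[OF diff] by metis
    define p where "p = \<theta> - \<alpha> / 2"
    have p: "p < \<theta>" "\<theta> - \<alpha> < p" "p \<in> {\<theta>-\<alpha><..\<theta>}" using \<theta> by (auto simp: p_def)
    have sub: "{p..\<theta>} \<subseteq> {\<theta>-\<alpha><..\<theta>}" using p by auto
    have xi: "(xb has_vector_derivative x' s) (at s)" if "s \<in> {\<theta>-\<alpha><..<\<theta>}" for s
    proof -
      have "(xb has_vector_derivative x' s) (at s within {\<theta>-\<alpha><..<\<theta>})"
        by (rule has_vector_derivative_within_subset[OF x(1)]) (use that in auto)
      then show ?thesis by (simp only: at_within_open[OF that open_greaterThanLessThan])
    qed
    have v: "velocity_left t0 t1 xb t = x' t" if t: "t \<in> {p..\<theta>}" for t
    proof (rule velocity_left_eq)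
      show "\<theta> - \<alpha> < t" using t p by auto
      have "{\<theta>-\<alpha><..<t} \<subseteq> interior {t0..t1}" using S t by (intro interior_maximal) auto
      then show "{\<theta>-\<alpha><..<t} \<subseteq> {t0<..<t1}" by simp
      show "(xb has_vector_derivative x' s) (at s)" if "s \<in> {\<theta>-\<alpha><..<t}" for s
        by (rule xi) (use that t in auto)
      have "(x' \<longlongrightarrow> x' t) (at t within {\<theta>-\<alpha><..\<theta>})"
        using has_vector_derivative_continuous[OF x(2)[of t]] t sub by (auto simp: continuous_within)
      \<comment> \<open>The midpoint of \<open>p\<close> and \<open>\<theta> - \<alpha>\<close>, to
        the left of \<open>t\<close> even for \<open>t = p\<close>.\<close>
      then have "(x' \<longlongrightarrow> x' t) (at t within {(p + \<theta> - \<alpha>) / 2..t})"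
        by (rule tendsto_within_subset) (use t p in auto)
      then show "(x' \<longlongrightarrow> x' t) (at_left t)"
        using t p by (simp add: at_within_Icc_at_left)
    qed
    show "G deriv_left L xb (velocity_left t0 t1 xb) \<theta> lam \<eta> \<ge> 0"
    proof (rule cond(1)[where p = p and q = \<theta> and x' = x' and x'' = x'' and U = "{p<..\<theta>}"])
      show "t0 \<le> p" using S p(3) by auto
      show "(xb has_vector_derivative x' t) (at t within {p..\<theta>})"
        "(x' has_vector_derivative x'' t) (at t within {p..\<theta>})" if "t \<in> {p..\<theta>}" for t
        by (rule has_vector_derivative_within_subset[OF x(1) sub], use that sub in blast,
            rule has_vector_derivative_within_subset[OF x(2) sub], use that sub in blast)
      show "(x'' has_vector_derivative x''' \<theta>) (at \<theta> within {p..\<theta>})"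
        by (rule has_vector_derivative_within_subset[OF x(3) sub]) (use p in auto)
      show "\<forall>\<^sub>F t in at \<theta> within {p..\<theta>}. t \<in> {p<..\<theta>}"
        using p(1) by (auto simp: at_within_Icc_at_left eventually_at_left_field intro: exI[of _ p])
    qed (use \<theta> p lam EW v deriv_left_eq in auto)
  next
    fix \<theta> \<eta> lam
    assume \<theta>: "\<theta> \<in> {t0<..<t1}" and diff: "thrice_differentiable_at xb \<theta>" and lam: "lam \<in> {0<..<1}"
      and E: "E L xb (velocity t0 t1 xb) \<theta> \<eta> = 0"
        "E L xb (velocity t0 t1 xb) \<theta> ((inverse (lam - 1) * lam) *\<^sub>R \<eta>) = 0"
    obtain \<epsilon> x' x'' d where \<epsilon>: "\<epsilon> > 0" and x: "\<And>t. t \<in> {\<theta>-\<epsilon><..<\<theta>+\<epsilon>} \<Longrightarrow> (xb has_vector_derivative x' t) (at t)"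
      "\<And>t. t \<in> {\<theta>-\<epsilon><..<\<theta>+\<epsilon>} \<Longrightarrow> (x' has_vector_derivative x'' t) (at t)"
      "(x'' has_vector_derivative d) (at \<theta>)"
      using diff unfolding thrice_differentiable_at_def by metis
    \<comment> \<open>Halving keeps the closed interval of radius \<open>h\<close> strictly inside
      both the region of differentiability and \<open>{t0<..<t1}\<close>.\<close>
    define h where "h = min \<epsilon> (min (\<theta> - t0) (t1 - \<theta>)) / 2"
    have h: "0 < h" "h < \<epsilon>" "h < \<theta> - t0" "h < t1 - \<theta>"
      using \<epsilon> \<theta> by (auto simp: h_def min_def)
    have near: "t \<in> {\<theta>-\<epsilon><..<\<theta>+\<epsilon>}" "t \<in> {t0<..<t1}" if "t \<in> {\<theta>-h..\<theta>+h}" for t using that h by auto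
    have D: "deriv F t = m" if "t \<in> {\<theta>-h<..<\<theta>+h}" "(F has_real_derivative m) (at t within {\<theta>-h..\<theta>+h})" for t F m
    proof -
      have "(F has_real_derivative m) (at t within {\<theta>-h<..<\<theta>+h})"
        by (rule has_field_derivative_subset[OF that(2)]) auto
      then show ?thesis
        by (simp only: at_within_open[OF that(1) open_greaterThanLessThan] DERIV_imp_deriv)
    qed
    have U: "\<forall>\<^sub>F t in at \<theta> within {\<theta>-h..\<theta>+h}. t \<in> {\<theta>-h<..<\<theta>+h}"
      unfolding eventually_at_filter
      by (rule eventually_mono[OF eventually_nhds_in_open[of "{\<theta>-h<..<\<theta>+h}"]]) (use h in auto)
    have v: "velocity t0 t1 xb t = x' t" if "t \<in> {\<theta>-h..\<theta>+h}" for t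
      by (rule velocity_interior) (use near[OF that] x(1) in auto)
    have x_within: "(xb has_vector_derivative x' t) (at t within {\<theta>-h..\<theta>+h})"
      "(x' has_vector_derivative x'' t) (at t within {\<theta>-h..\<theta>+h})" if "t \<in> {\<theta>-h..\<theta>+h}" for t
      using x(1,2) near(1)[OF that] has_vector_derivative_at_within by blast+
    have order: "t0 \<le> \<theta> - h" "\<theta> - h < \<theta> + h" "\<theta> + h \<le> t1" using h by auto
    have mem: "\<theta> \<in> {\<theta>-h..\<theta>+h}" "\<theta> \<in> {\<theta>-h<..<\<theta>+h}" "{\<theta>-h<..<\<theta>+h} \<subseteq> {\<theta>-h..\<theta>+h}" using h by auto
    note condition = cond[where v = "velocity t0 t1 xb" and D = deriv and U = "{\<theta>-h<..<\<theta>+h}",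
        OF order x_within has_vector_derivative_at_within[OF x(3)] mem(1) lam]
    have W0: "W deriv L xb (velocity t0 t1 xb) \<theta> lam \<eta> = 0"
      by (rule condition(2)) (assumption | fact v D mem U E)+
    show "G deriv L xb (velocity t0 t1 xb) \<theta> lam \<eta> \<ge> 0"
      by (rule condition(1)) (assumption | fact v D mem U E W0)+
  }
qed

end
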